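(* Let $\alpha>-\tfrac12$ and $n\in\mathbb{N}=\{0,1,2,\dots\}$. For $u,v\ge 0$ and $\phi\in[0,\pi]$ put $\delta(u,v,\phi)=\sqrt{u^2+v^2-2uv\cos\phi}$. Then for all $u,v\ge0$, $$u^{n}j_{\alpha+n}(u)\,j_{\alpha}(v)=C_\alpha\int_0^\pi j_{\alpha+n}\big(\delta(u,v,\phi)\big)\,\delta(u,v,\phi)^{n}\,P_n^\alpha\!\left(\frac{u-v\cos\phi}{\delta(u,v,\phi)}\right)(\sin\phi)^{2\alpha}\,d\phi ,$$ where, when $\delta(u,v,\phi)=0$, the product $\delta^nP_n^\alpha(\cdots)$ is given the value $0$ if $n\ge1$ and $1$ if $n=0$. Equivalently, for $u,v>0$, $$u^{n}j_{\alpha+n}(u)\,j_{\alpha}(v)=\int_0^{\infty} w^{n}j_{\alpha+n}(w)\,K_B^\alpha(u,v,w)\,P_n^\alpha\!\left(\frac{u^2+w^2-v^2}{2uw}\right)w^{2\alpha+1}\,dw .$$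
   Context: For $\beta>-\tfrac12$, $j_\beta$ denotes the normalized Bessel function $j_\beta(z)=\Gamma(\beta+1)(z/2)^{-\beta}J_\beta(z)=\Gamma(\beta+1)\sum_{k\ge0}\frac{(-1)^k}{k!\,\Gamma(\beta+k+1)}(z/2)^{2k}$, so $j_\beta(0)=1$. $C_\alpha=\frac{\Gamma(\alpha+1)}{\sqrt{\pi}\,\Gamma(\alpha+1/2)}$. $(a)_m=a(a+1)\cdots(a+m-1)$ is the Pochhammer symbol. For $\alpha>-\tfrac12$, $\alpha\neq0$, the Gegenbauer polynomial is $C_m^\alpha(t)=\frac{1}{\Gamma(\alpha)}\sum_{k=0}^{[m/2]}(-1)^k\frac{\Gamma(m-k+\alpha)}{k!(m-2k)!}(2t)^{m-2k}$, and the normalized Gegenbauer polynomial is $P_m^\alpha(t)=\frac{m!}{(2\alpha)_m}C_m^\alpha(t)$; for $\alpha=0$, $P_m^0(t)=\lim_{\alpha\to0}P_m^\alpha(t)=T_m(t)$, the Chebyshev polynomial of the first kind. The Bessel kernel is $K_B^\alpha(u,v,w)=2^{-2\alpha+1}C_\alpha\frac{\{[(u+v)^2-w^2][w^2-(u-v)^2]\}^{\alpha-1/2}}{(uvw)^{2\alpha}}$ for $|u-v|<w<u+v$ and $K_B^\alpha(u,v,w)=0$ otherwise ($u,v,w>0$). *)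

theory Defs
  imports "HOL-Analysis.Analysis"
begin

definition bessel_j :: "real \<Rightarrow> real \<Rightarrow> real" where
  "bessel_j \<beta> z = Gamma (\<beta> + 1) *
     (\<Sum>k. (-1) ^ k / (fact k * Gamma (\<beta> + real k + 1)) * (z / 2) ^ (2 * k))"

definition C_const :: "real \<Rightarrow> real" where
  "C_const \<alpha> = Gamma (\<alpha> + 1) / (sqrt pi * Gamma (\<alpha> + 1 / 2))"

text \<open>Gegenbauer polynomial C_m^alpha (alpha ~= 0).\<close>
definition gegenbauer :: "nat \<Rightarrow> real \<Rightarrow> real \<Rightarrow> real" where
  "gegenbauer m \<alpha> t = (1 / Gamma \<alpha>) *
     (\<Sum>k = 0..m div 2. (-1) ^ k * Gamma (real (m - k) + \<alpha>) / (fact k * fact (m - 2 * k))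
        * (2 * t) ^ (m - 2 * k))"

fun chebyshev_T :: "nat \<Rightarrow> real \<Rightarrow> real" where
  "chebyshev_T 0 t = 1"
| "chebyshev_T (Suc 0) t = t"
| "chebyshev_T (Suc (Suc n)) t = 2 * t * chebyshev_T (Suc n) t - chebyshev_T n t"

definition norm_gegenbauer :: "nat \<Rightarrow> real \<Rightarrow> real \<Rightarrow> real" where
  "norm_gegenbauer m \<alpha> t =
     (if \<alpha> = 0 then chebyshev_T m t
      else fact m / pochhammer (2 * \<alpha>) m * gegenbauer m \<alpha> t)"

definition bessel_kernel :: "real \<Rightarrow> real \<Rightarrow> real \<Rightarrow> real \<Rightarrow> real" where
  "bessel_kernel \<alpha> u v w =
     (if \<bar>u - v\<bar> < w \<and> w < u + v then
        2 powr (- 2 * \<alpha> + 1) * C_const \<alpha> *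
        (((u + v)^2 - w^2) * (w^2 - (u - v)^2)) powr (\<alpha> - 1 / 2) / (u * v * w) powr (2 * \<alpha>)
      else 0)"

definition delta :: "real \<Rightarrow> real \<Rightarrow> real \<Rightarrow> real" where
  "delta u v \<phi> = sqrt (u^2 + v^2 - 2 * u * v * cos \<phi>)"

definition delta_gegen :: "nat \<Rightarrow> real \<Rightarrow> real \<Rightarrow> real \<Rightarrow> real \<Rightarrow> real" where
  "delta_gegen n \<alpha> u v \<phi> =
     (if delta u v \<phi> = 0 then (if n = 0 then 1 else 0)
      else delta u v \<phi> ^ n * norm_gegenbauer n \<alpha> ((u - v * cos \<phi>) / delta u v \<phi>))"

end

theory Submission
  imports Defs
begin

text \<open>
  The product \<open>F\<^sub>n = j\<^bsub>\<alpha>+n\<^esub>(r) r\<^sup>n P\<^sub>n\<^sup>\<alpha>(x/r)\<close> is an axially symmetric solution of the Helmholtz equation in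
  "dimension" \<open>2\<alpha> + 2\<close>, and the theorem is its mean value property over the sphere of radius \<open>v\<close>
  centred at distance \<open>u\<close> on the axis. For \<open>n = 0\<close> this is Gegenbauer's product formula, obtained by comparing
  power series: the moments of \<open>cos\<close> against \<open>sin\<^sup>2\<^sup>\<alpha>\<close> turn it into the Chu-Vandermonde identity. Moving the
  centre along the axis gives \<open>\<partial>\<^sub>u F\<^sub>n = n F\<^bsub>n-1\<^esub> - b\<^sub>n F\<^bsub>n+1\<^esub>\<close> with \<open>b\<^sub>n > 0\<close>, so differentiating the
  identities for \<open>n - 1\<close> and \<open>n\<close> under the integral yields the one for \<open>n + 1\<close>. The kernel form is the
  substitution \<open>w = \<delta>(u, v, \<phi>)\<close>.
\<close>

subsection \<open>Gegenbauer polynomials as solid harmonics\<close>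

lemma notin_nonpos_Ints_gt_minus1:
  fixes x :: real
  assumes "x > - 1" "x \<noteq> 0"
  shows "x \<notin> \<int>\<^sub>\<le>\<^sub>0"
  using assms by (auto elim!: nonpos_Ints_cases)

text \<open>The factor \<open>1 / Gamma \<alpha>\<close> is left out and \<open>s\<close> stands for
  \<open>2 * t\<close>. Padding with zeros past k = m div 2 lets sums of consecutive degrees share
  one index range.\<close>

definition gegenbauer_term :: "real \<Rightarrow> nat \<Rightarrow> real \<Rightarrow> nat \<Rightarrow> real" where
  "gegenbauer_term \<alpha> m s k =
     (if 2 * k \<le> m then (-1) ^ k * Gamma (real (m - k) + \<alpha>) / (fact k * fact (m - 2 * k)) * s ^ (m - 2 * k)
      else 0)"

lemma gegenbauer_eq_sum_term:
  assumes "m div 2 \<le> K"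
  shows "gegenbauer m \<alpha> t = (\<Sum>k\<le>K. gegenbauer_term \<alpha> m (2 * t) k) / Gamma \<alpha>"
proof -
  have "(\<Sum>k = 0..m div 2. (-1) ^ k * Gamma (real (m - k) + \<alpha>) / (fact k * fact (m - 2 * k))
        * (2 * t) ^ (m - 2 * k)) = (\<Sum>k\<le>K. gegenbauer_term \<alpha> m (2 * t) k)"
    using assms by (intro sum.mono_neutral_cong_left) (auto simp: gegenbauer_term_def)
  then show ?thesis
    by (simp add: gegenbauer_def)
qed

text \<open>The three-term recurrence holds term by term once the sum of degree m is shifted by one
  index: every power of s is then s^(m+2-2k), and Gamma(z+1) = z Gamma(z) leaves a rational identity
  in m, k and \<alpha>.\<close>

lemma gegenbauer_term_recurrence:
  assumes "\<alpha> > - 1 / 2" "\<alpha> \<noteq> 0"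
  shows "(real m + 2) * gegenbauer_term \<alpha> (Suc (Suc m)) s k =
     (real m + 1 + \<alpha>) * s * gegenbauer_term \<alpha> (Suc m) s k
     - (real m + 2 * \<alpha>) * (if k = 0 then 0 else gegenbauer_term \<alpha> m s (k - 1))"
proof -
  have Gamma_Suc: "Gamma (real j + 1 + \<alpha>) = (real j + \<alpha>) * Gamma (real j + \<alpha>)" for j
  proof -
    have "real j + \<alpha> \<noteq> 0"
      using assms by (cases j) auto
    then have "real j + \<alpha> \<notin> \<int>\<^sub>\<le>\<^sub>0"
      using assms by (intro notin_nonpos_Ints_gt_minus1) auto
    then show ?thesis
      using Gamma_plus1[of "real j + \<alpha>"] by (simp add: add_ac)
  qed
  \<comment> \<open>In order: all terms vanish; 2k = m+2, where the middle term is absent; k = 0,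
    where the shifted term is absent; the generic case, with q = m+1-2k.\<close>
  consider "2 * k > m + 2" | j where "k = Suc j" "m = 2 * j" | "k = 0"
    | j q where "k = Suc j" "m = 2 * j + 1 + q"
  proof (cases k)
    case 0
    then show ?thesis using that by blast
  next
    case (Suc j)
    show ?thesis
    proof (cases "2 * k \<le> m + 1")
      case True
      then obtain q where "m + 1 = 2 * k + q" using le_Suc_ex by blast
      then show ?thesis using that(4)[of j q] Suc by simp
    next
      case False
      then show ?thesis using that(1) that(2)[of j] Suc by linarith
    qed
  qed
  then show ?thesis
  proof cases
    case 1
    then show ?thesis by (auto simp: gegenbauer_term_def)
  next
    case (2 j)
    have "Gamma (1 + (real j + \<alpha>)) = (real j + \<alpha>) * Gamma (real j + \<alpha>)"
      using Gamma_Suc[of j] by (simp add: add_ac)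
    with 2 show ?thesis
      by (simp add: gegenbauer_term_def divide_simps) (simp add: algebra_simps)
  next
    case 3
    have "Gamma (2 + (real m + \<alpha>)) = (real m + 1 + \<alpha>) * Gamma (1 + (real m + \<alpha>))"
      using Gamma_Suc[of "Suc m"] by (simp add: add_ac)
    with 3 show ?thesis
      by (simp add: gegenbauer_term_def divide_simps add_ac)
  next
    case (4 j q)
    define g where "g = Gamma (real (j + q + 1) + \<alpha>)"
    have G: "Gamma (real (j + q + 2) + \<alpha>) = (real (j + q + 1) + \<alpha>) * g"
      using Gamma_Suc[of "j + q + 1"] by (simp add: add_ac g_def)
    have t2: "gegenbauer_term \<alpha> (Suc (Suc m)) s k =
        (-1) ^ Suc j * ((real (j + q + 1) + \<alpha>) * g) / (fact (Suc j) * fact (Suc q)) * s ^ Suc q"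
      using 4 G by (simp add: gegenbauer_term_def add_ac)
    have t1: "gegenbauer_term \<alpha> (Suc m) s k = (-1) ^ Suc j * g / (fact (Suc j) * fact q) * s ^ q"
      using 4 by (simp add: gegenbauer_term_def g_def)
    have t0: "(if k = 0 then 0 else gegenbauer_term \<alpha> m s (k - 1)) =
        (-1) ^ j * g / (fact j * fact (Suc q)) * s ^ Suc q"
      using 4 by (simp add: gegenbauer_term_def g_def)
    have m: "real m = 2 * real j + 1 + real q"
      using 4 by simp
    show ?thesis
      unfolding t2 t1 t0 m by (simp add: divide_simps) (simp add: algebra_simps)
  qed
qed

lemma gegenbauer_recurrence:
  assumes "\<alpha> > - 1 / 2" "\<alpha> \<noteq> 0"
  shows "(real m + 2) * gegenbauer (Suc (Suc m)) \<alpha> t =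
     2 * (real m + 1 + \<alpha>) * t * gegenbauer (Suc m) \<alpha> t - (real m + 2 * \<alpha>) * gegenbauer m \<alpha> t"
proof -
  let ?a = "\<lambda>m. gegenbauer_term \<alpha> m (2 * t)"
  have "(\<Sum>k\<le>Suc m. (real m + 2) * ?a (Suc (Suc m)) k) =
      (\<Sum>k\<le>Suc m. (real m + 1 + \<alpha>) * (2 * t) * ?a (Suc m) k)
      - (\<Sum>k\<le>Suc m. (real m + 2 * \<alpha>) * (if k = 0 then 0 else ?a m (k - 1)))"
    using gegenbauer_term_recurrence[OF assms] by (simp flip: sum_subtractf)
  moreover have "(\<Sum>k\<le>Suc m. (real m + 2 * \<alpha>) * (if k = 0 then 0 else ?a m (k - 1))) =
      (\<Sum>k\<le>m. (real m + 2 * \<alpha>) * ?a m k)"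
    by (subst sum.atMost_Suc_shift) simp
  ultimately have "(real m + 2) * (\<Sum>k\<le>Suc m. ?a (Suc (Suc m)) k) =
      (real m + 1 + \<alpha>) * (2 * t) * (\<Sum>k\<le>Suc m. ?a (Suc m) k) - (real m + 2 * \<alpha>) * (\<Sum>k\<le>m. ?a m k)"
    by (simp only: sum_distrib_left)
  then show ?thesis
    using gegenbauer_eq_sum_term[of "Suc (Suc m)" "Suc m"] gegenbauer_eq_sum_term[of "Suc m" "Suc m"]
      gegenbauer_eq_sum_term[of m m]
    by (simp add: diff_divide_distrib mult_ac del: sum.atMost_Suc)
qed

lemma norm_gegenbauer_0: "\<alpha> > - 1 / 2 \<Longrightarrow> norm_gegenbauer 0 \<alpha> t = 1"
  by (auto simp: norm_gegenbauer_def gegenbauer_def Gamma_eq_zero_iff elim!: nonpos_Ints_cases)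

lemma norm_gegenbauer_1: "\<alpha> > - 1 / 2 \<Longrightarrow> norm_gegenbauer (Suc 0) \<alpha> t = t"
proof (cases "\<alpha> = 0")
  case False
  assume \<alpha>: "\<alpha> > - 1 / 2"
  with False have "\<alpha> \<notin> \<int>\<^sub>\<le>\<^sub>0" by (auto elim!: nonpos_Ints_cases)
  then have "Gamma (1 + \<alpha>) = \<alpha> * Gamma \<alpha>" "Gamma \<alpha> \<noteq> 0"
    using Gamma_plus1[of \<alpha>] False by (auto simp: add_ac Gamma_eq_zero_iff)
  then show ?thesis using False by (simp add: norm_gegenbauer_def gegenbauer_def)
qed (simp add: norm_gegenbauer_def)

text \<open>The factor m!/(2\<alpha>)_m makes the recurrence regular at \<alpha> = 0, where it
  becomes the Chebyshev one, so both branches of \<open>norm_gegenbauer\<close> obey a single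
  formula. The divisor m+1+2\<alpha> is positive since \<alpha> > -1/2.\<close>

lemma norm_gegenbauer_recurrence:
  assumes \<alpha>: "\<alpha> > - 1 / 2"
  shows "norm_gegenbauer (Suc (Suc m)) \<alpha> t =
     (2 * (real m + 1 + \<alpha>) * t * norm_gegenbauer (Suc m) \<alpha> t - (real m + 1) * norm_gegenbauer m \<alpha> t)
       / (real m + 1 + 2 * \<alpha>)"
proof (cases "\<alpha> = 0")
  case True
  then show ?thesis by (simp add: norm_gegenbauer_def field_simps)
next
  case False
  define p where "p = pochhammer (2 * \<alpha>) m"
  have "2 * \<alpha> \<noteq> - real k" for k
    using \<alpha> False by (cases k) auto
  then have p: "p \<noteq> 0" by (auto simp: p_def pochhammer_eq_0_iff)
  have pos: "2 * \<alpha> + real m \<noteq> 0" "2 * \<alpha> + real (Suc m) \<noteq> 0"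
    using \<alpha> False by (cases m; simp)+
  have P: "pochhammer (2 * \<alpha>) (Suc m) = p * (2 * \<alpha> + real m)"
    "pochhammer (2 * \<alpha>) (Suc (Suc m)) = p * (2 * \<alpha> + real m) * (2 * \<alpha> + real (Suc m))"
    by (simp_all add: pochhammer_rec' p_def mult_ac)
  have F: "fact (Suc m) = (real m + 1) * fact m" "fact (Suc (Suc m)) = (real m + 2) * (real m + 1) * fact m"
    by (simp_all add: algebra_simps)
  have "norm_gegenbauer (Suc (Suc m)) \<alpha> t = (real m + 1) * fact m / (p * (2 * \<alpha> + real m) * (2 * \<alpha> + real (Suc m)))
      * ((real m + 2) * gegenbauer (Suc (Suc m)) \<alpha> t)"
    using False unfolding norm_gegenbauer_def P F by simp
  also have "\<dots> = (2 * (real m + 1 + \<alpha>) * t * norm_gegenbauer (Suc m) \<alpha> t - (real m + 1) * norm_gegenbauer m \<alpha> t)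
       / (real m + 1 + 2 * \<alpha>)"
    using False pos p unfolding gegenbauer_recurrence[OF \<alpha> False] norm_gegenbauer_def P F
    by (simp add: divide_simps flip: p_def) (simp add: algebra_simps)
  finally show ?thesis .
qed

text \<open>\<open>r\<^sup>n P\<^sub>n\<^sup>\<alpha>(x/r)\<close> as a polynomial in \<open>x\<close> and \<open>\<rho> = r\<^sup>2\<close>; the recurrence is also valid for \<open>\<alpha> = 0\<close>.\<close>
fun solid_gegenbauer :: "real \<Rightarrow> nat \<Rightarrow> real \<Rightarrow> real \<Rightarrow> real" where
  "solid_gegenbauer \<alpha> 0 x \<rho> = 1"
| "solid_gegenbauer \<alpha> (Suc 0) x \<rho> = x"
| "solid_gegenbauer \<alpha> (Suc (Suc n)) x \<rho> =
     (2 * (real n + 1 + \<alpha>) * x * solid_gegenbauer \<alpha> (Suc n) x \<rho> - (real n + 1) * \<rho> * solid_gegenbauer \<alpha> n x \<rho>)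
       / (real n + 1 + 2 * \<alpha>)"

text \<open>Homogenization: multiplying the recurrence at t = x/r by r^(n+2) turns t into x and the
  coefficient of the lowest term into a multiple of r^2.\<close>

lemma solid_gegenbauer_eq_norm_gegenbauer:
  assumes "\<alpha> > - 1 / 2" "r \<noteq> 0"
  shows "solid_gegenbauer \<alpha> n x (r\<^sup>2) = r ^ n * norm_gegenbauer n \<alpha> (x / r)"
proof (induction n rule: induct_nat_012)
  case (ge2 n)
  define P Q where "P = norm_gegenbauer n \<alpha> (x / r)" and "Q = norm_gegenbauer (Suc n) \<alpha> (x / r)"
  have "2 * (real n + 1 + \<alpha>) * x * (r ^ Suc n * Q) - (real n + 1) * r\<^sup>2 * (r ^ n * P) =
      r ^ Suc (Suc n) * (2 * (real n + 1 + \<alpha>) * (x / r) * Q - (real n + 1) * P)"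
    using assms(2) by (simp add: field_simps power2_eq_square)
  then show ?case
    using ge2 by (simp add: norm_gegenbauer_recurrence[OF assms(1)] P_def Q_def)
qed (use assms in \<open>simp_all add: norm_gegenbauer_0 norm_gegenbauer_1\<close>)

text \<open>These are the values that \<open>delta_gegen\<close> prescribes at distance 0.\<close>

lemma solid_gegenbauer_origin: "solid_gegenbauer \<alpha> n 0 0 = (if n = 0 then 1 else 0)"
  by (induction n rule: induct_nat_012) simp_all

text \<open>The normalization P_n(1) = 1 in homogeneous form, valid for x of either sign.\<close>

lemma solid_gegenbauer_axis:
  assumes "\<alpha> > - 1 / 2"
  shows "solid_gegenbauer \<alpha> n x (x\<^sup>2) = x ^ n"
proof (induction n rule: induct_nat_012)
  case (ge2 n)
  have "2 * (real n + 1 + \<alpha>) * x * x ^ Suc n - (real n + 1) * x\<^sup>2 * x ^ n =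
      x ^ Suc (Suc n) * (real n + 1 + 2 * \<alpha>)"
    by (simp add: algebra_simps power2_eq_square)
  then show ?case using ge2 assms by simp
qed simp_all

lemma continuous_on_solid_gegenbauer [continuous_intros]:
  fixes x \<rho> :: "'a :: topological_space \<Rightarrow> real"
  assumes "\<alpha> > - 1 / 2" "continuous_on A x" "continuous_on A \<rho>"
  shows "continuous_on A (\<lambda>t. solid_gegenbauer \<alpha> n (x t) (\<rho> t))"
  using assms by (induction n rule: induct_nat_012) (auto intro!: continuous_intros)

lemma solid_gegenbauer_recurrence:
  assumes "\<alpha> > - 1 / 2"
  shows "2 * (real n + 1 + \<alpha>) * x * solid_gegenbauer \<alpha> (Suc n) x \<rho> =
    (real n + 1 + 2 * \<alpha>) * solid_gegenbauer \<alpha> (Suc (Suc n)) x \<rho> + (real n + 1) * \<rho> * solid_gegenbauer \<alpha> n x \<rho>"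
  using assms by (simp add: field_simps)

text \<open>The hypotheses on \<open>x\<close> and \<open>\<rho>\<close> say that \<open>\<rho> - x\<^sup>2\<close> is constant: one moves parallel to the axis.\<close>
lemma has_field_derivative_solid_gegenbauer:
  assumes \<alpha>: "\<alpha> > - 1 / 2"
    and x: "(x has_field_derivative 1) (at t)" and \<rho>: "(\<rho> has_field_derivative 2 * x t) (at t)"
  shows "((\<lambda>t. solid_gegenbauer \<alpha> n (x t) (\<rho> t)) has_field_derivative
     real n * solid_gegenbauer \<alpha> (n - 1) (x t) (\<rho> t)) (at t)"
proof (induction n rule: induct_nat_012)
  case 1
  then show ?case using x by simp
next
  case (ge2 n)
  let ?H = "\<lambda>n. solid_gegenbauer \<alpha> n (x t) (\<rho> t)"
  have nz: "real n + 1 + 2 * \<alpha> \<noteq> 0" using \<alpha> by simp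
  \<comment> \<open>The recurrence one degree lower, which collapses the result of the product rule
    to a multiple of \<open>?H (Suc n)\<close>. For n = 0, where n - 1 is truncated, both sides are
    2\<alpha> times x.\<close>
  have low: "2 * (real n + \<alpha>) * x t * ?H n = (real n + 2 * \<alpha>) * ?H (Suc n) + real n * \<rho> t * ?H (n - 1)"
    using solid_gegenbauer_recurrence[OF \<alpha>, of "n - 1" "x t" "\<rho> t"] by (cases n) (auto simp: add_ac simp del: solid_gegenbauer.simps(3))
  have "((\<lambda>t. solid_gegenbauer \<alpha> (Suc (Suc n)) (x t) (\<rho> t)) has_field_derivative
      (2 * (real n + 1 + \<alpha>) * (?H (Suc n) + x t * (real (Suc n) * ?H n))
        - (real n + 1) * (2 * x t * ?H n + \<rho> t * (real n * ?H (n - 1)))) / (real n + 1 + 2 * \<alpha>)) (at t)"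
    unfolding solid_gegenbauer.simps(3)
    by (rule DERIV_cdivide)
      (auto intro!: derivative_eq_intros x \<rho> ge2(1) ge2(2)[unfolded diff_Suc_1] simp: algebra_simps
        simp del: solid_gegenbauer.simps(3))
  also have "(2 * (real n + 1 + \<alpha>) * (?H (Suc n) + x t * (real (Suc n) * ?H n))
        - (real n + 1) * (2 * x t * ?H n + \<rho> t * (real n * ?H (n - 1)))) =
      2 * (real n + 1 + \<alpha>) * ?H (Suc n) + (real n + 1) * (2 * (real n + \<alpha>) * x t * ?H n - real n * \<rho> t * ?H (n - 1))"
    by (simp add: algebra_simps)
  also have "\<dots> = (real n + 1 + 2 * \<alpha>) * (real (Suc (Suc n)) * ?H (Suc n))"
    unfolding low by (simp add: algebra_simps)
  finally show ?case using nz by simp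
qed simp

subsection \<open>Bessel series\<close>

text \<open>Taylor coefficients of j_\<beta> in the variable z^2, with
  Gamma(\<beta>+1)/Gamma(\<beta>+k+1) written as a reciprocal Pochhammer symbol.\<close>

definition bessel_coeff :: "real \<Rightarrow> nat \<Rightarrow> real" where
  "bessel_coeff \<beta> k = (- 1 / 4) ^ k / (fact k * pochhammer (\<beta> + 1) k)"

text \<open>The normalized Bessel function in the variable \<open>\<rho> = z\<^sup>2\<close>, which is smooth at \<open>z = 0\<close>.\<close>
definition bessel_entire :: "real \<Rightarrow> real \<Rightarrow> real" where
  "bessel_entire \<beta> \<rho> = (\<Sum>k. bessel_coeff \<beta> k * \<rho> ^ k)"

lemma bessel_coeff_0: "bessel_coeff \<beta> 0 = 1"
  by (simp add: bessel_coeff_def)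

text \<open>Each factor \<beta>+1+k exceeds 1/2. This crude bound suffices to dominate the Bessel
  series by that of exp(|\<rho>|/2).\<close>

lemma pochhammer_ge_half_power:
  fixes \<beta> :: real
  assumes "\<beta> > - 1 / 2"
  shows "(1 / 2) ^ k \<le> pochhammer (\<beta> + 1) k"
proof (induction k)
  case (Suc k)
  have "(1 / 2) * (1 / 2) ^ k \<le> (\<beta> + 1 + real k) * pochhammer (\<beta> + 1) k"
    using Suc assms by (intro mult_mono) auto
  then show ?case by (simp add: pochhammer_rec' add_ac)
qed simp

lemma summable_norm_bessel_coeff:
  assumes "\<beta> > - 1 / 2"
  shows "summable (\<lambda>k. norm (bessel_coeff \<beta> k * \<rho> ^ k))"
proof (rule summable_comparison_test')
  show "summable (\<lambda>k. (\<bar>\<rho>\<bar> / 2) ^ k / fact k)"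
    using summable_exp[of "\<bar>\<rho>\<bar> / 2"] unfolding divide_inverse_commute[of "_ ^ _"] .
  fix k :: nat
  have P: "(1 / 2) ^ k \<le> pochhammer (\<beta> + 1) k" "pochhammer (\<beta> + 1) k > 0"
    using assms by (auto intro: pochhammer_ge_half_power pochhammer_pos)
  have "\<bar>(- 1 / 4 :: real) ^ k\<bar> = (1 / 4) ^ k" by (simp add: power_abs)
  then have "norm (bessel_coeff \<beta> k * \<rho> ^ k) = (\<bar>\<rho>\<bar> / 4) ^ k / fact k / pochhammer (\<beta> + 1) k"
    using P unfolding bessel_coeff_def real_norm_def abs_mult abs_divide power_abs[of \<rho>]
    by (simp add: power_divide)
  also have "\<dots> \<le> (\<bar>\<rho>\<bar> / 4) ^ k / fact k / (1 / 2) ^ k"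
    using P by (intro divide_left_mono) auto
  also have "\<dots> = ((\<bar>\<rho>\<bar> / 4) / (1 / 2)) ^ k / fact k"
    unfolding power_divide[of "\<bar>\<rho>\<bar> / 4" "1 / 2"] by simp
  also have "(\<bar>\<rho>\<bar> / 4) / (1 / 2) = \<bar>\<rho>\<bar> / 2" by simp
  finally show "norm (norm (bessel_coeff \<beta> k * \<rho> ^ k)) \<le> (\<bar>\<rho>\<bar> / 2) ^ k / fact k" by simp
qed

lemma summable_bessel_coeff:
  "\<beta> > - 1 / 2 \<Longrightarrow> summable (\<lambda>k. bessel_coeff \<beta> k * \<rho> ^ k)"
  by (rule summable_norm_cancel) (rule summable_norm_bessel_coeff)

lemma bessel_j_eq_bessel_entire:
  assumes "\<beta> > - 1 / 2"
  shows "bessel_j \<beta> z = bessel_entire \<beta> (z\<^sup>2)"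
proof -
  have nz: "\<beta> + 1 \<notin> \<int>\<^sub>\<le>\<^sub>0" "\<And>k. \<beta> + 1 + real k \<notin> \<int>\<^sub>\<le>\<^sub>0"
    using assms by (intro notin_nonpos_Ints_gt_minus1; simp)+
  then have G: "Gamma (\<beta> + 1) \<noteq> 0" by (simp add: Gamma_eq_zero_iff)
  have "(-1) ^ k / (fact k * Gamma (\<beta> + real k + 1)) * (z / 2) ^ (2 * k) =
      bessel_coeff \<beta> k * (z\<^sup>2) ^ k / Gamma (\<beta> + 1)" for k
  proof -
    have "Gamma (\<beta> + real k + 1) = pochhammer (\<beta> + 1) k * Gamma (\<beta> + 1)"
      using G pochhammer_Gamma[OF nz(1), of k] by (simp add: add_ac)
    moreover have "(z / 2) ^ (2 * k) = (1 / 4) ^ k * (z\<^sup>2) ^ k"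
      by (simp add: power_mult power_divide)
    moreover have "(- 1 / 4) ^ k = (-1) ^ k * (1 / 4 :: real) ^ k"
      using power_mult_distrib[of "-1" "1 / 4 :: real" k] by simp
    ultimately show ?thesis by (simp add: bessel_coeff_def)
  qed
  then show ?thesis
    using G suminf_divide[OF summable_bessel_coeff[OF assms], of "z\<^sup>2" "Gamma (\<beta> + 1)"]
    by (simp add: bessel_j_def bessel_entire_def)
qed

lemma bessel_coeff_Suc:
  assumes "\<beta> > - 1 / 2"
  shows "real (Suc k) * bessel_coeff \<beta> (Suc k) = - bessel_coeff (\<beta> + 1) k / (4 * (\<beta> + 1))"
proof -
  have "pochhammer (\<beta> + 2) k > 0" using assms by (intro pochhammer_pos) auto
  then show ?thesis
    using assms by (simp add: bessel_coeff_def pochhammer_rec add_ac divide_simps)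
qed

text \<open>Termwise differentiation; in the variable z it is the classical j_\<beta>'(z) = -z
  j_{\<beta>+1}(z) / (2(\<beta>+1)).\<close>

lemma has_field_derivative_bessel_entire:
  assumes "\<beta> > - 1 / 2"
  shows "(bessel_entire \<beta> has_field_derivative - bessel_entire (\<beta> + 1) \<rho> / (4 * (\<beta> + 1))) (at \<rho>)"
proof -
  have "diffs (bessel_coeff \<beta>) k * \<rho> ^ k = bessel_coeff (\<beta> + 1) k * \<rho> ^ k * (- 1 / (4 * (\<beta> + 1)))" for k
    using bessel_coeff_Suc[OF assms, of k] by (simp add: diffs_def)
  then have "(\<Sum>k. diffs (bessel_coeff \<beta>) k * \<rho> ^ k) = bessel_entire (\<beta> + 1) \<rho> * (- 1 / (4 * (\<beta> + 1)))"
    using assms by (simp only: bessel_entire_def suminf_mult2[OF summable_bessel_coeff])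
  then show ?thesis
    using termdiffs_strong_converges_everywhere[OF summable_bessel_coeff[OF assms], of \<rho>]
    by (simp add: bessel_entire_def[abs_def])
qed

lemma continuous_on_bessel_entire [continuous_intros]:
  assumes "\<beta> > - 1 / 2" "continuous_on A f"
  shows "continuous_on A (\<lambda>x. bessel_entire \<beta> (f x))"
proof -
  have "continuous_on UNIV (bessel_entire \<beta>)"
    using has_field_derivative_bessel_entire[OF assms(1)]
    by (intro continuous_at_imp_continuous_on ballI DERIV_isCont)
  then show ?thesis
    using assms(2) by (rule continuous_on_compose2) auto
qed

text \<open>The normalized form of J_\<beta>(z) + J_{\<beta>+2}(z) = (2(\<beta>+1)/z)
  J_{\<beta>+1}(z). The constant terms of the first two series are both 1; for the others, the
  factor \<rho> shifts the last series by one, and coefficients are compared.\<close>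

lemma bessel_entire_contiguous:
  assumes "\<beta> > - 1 / 2"
  shows "bessel_entire \<beta> \<rho> =
    bessel_entire (\<beta> + 1) \<rho> - \<rho> / (4 * (\<beta> + 1) * (\<beta> + 2)) * bessel_entire (\<beta> + 2) \<rho>"
proof -
  let ?d = "4 * (\<beta> + 1) * (\<beta> + 2)"
  have tail: "(\<lambda>k. bessel_coeff \<gamma> (Suc k) * \<rho> ^ Suc k) sums (bessel_entire \<gamma> \<rho> - 1)"
    if "\<gamma> > - 1 / 2" for \<gamma>
    using summable_sums[OF summable_bessel_coeff[OF that], of \<rho>]
    unfolding sums_Suc_iff[where f = "\<lambda>k. bessel_coeff \<gamma> k * \<rho> ^ k"] bessel_entire_def
    by (simp add: bessel_coeff_0)
  have "bessel_coeff \<beta> (Suc k) = bessel_coeff (\<beta> + 1) (Suc k) - bessel_coeff (\<beta> + 2) k / ?d" for k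
  proof -
    define p where "p = pochhammer (\<beta> + 2) k"
    have p: "p > 0" unfolding p_def using assms by (intro pochhammer_pos) auto
    have e1: "pochhammer (\<beta> + 1) (Suc k) = (\<beta> + 1) * p"
      using pochhammer_rec[of "\<beta> + 1" k] by (simp add: p_def add_ac del: pochhammer_Suc)
    have e2: "pochhammer (\<beta> + 1 + 1) (Suc k) = p * (\<beta> + 2 + real k)"
      using pochhammer_Suc[of "\<beta> + 2" k] by (simp add: p_def add_ac del: pochhammer_Suc)
    have e3: "pochhammer (\<beta> + 2 + 1) k = p * (\<beta> + 2 + real k) / (\<beta> + 2)"
      using pochhammer_rec[of "\<beta> + 2" k] pochhammer_Suc[of "\<beta> + 2" k] assms
      by (simp add: p_def field_simps del: pochhammer_Suc)
    show ?thesis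
      unfolding bessel_coeff_def e1 e2 e3
      using p assms by (simp add: divide_simps) (simp add: algebra_simps)
  qed
  then have summand: "bessel_coeff (\<beta> + 1) (Suc k) * \<rho> ^ Suc k - \<rho> / ?d * (bessel_coeff (\<beta> + 2) k * \<rho> ^ k) =
      bessel_coeff \<beta> (Suc k) * \<rho> ^ Suc k" for k
    by (simp add: left_diff_distrib)
  have "(\<lambda>k. bessel_coeff (\<beta> + 1) (Suc k) * \<rho> ^ Suc k - \<rho> / ?d * (bessel_coeff (\<beta> + 2) k * \<rho> ^ k))
      sums (bessel_entire (\<beta> + 1) \<rho> - 1 - \<rho> / ?d * bessel_entire (\<beta> + 2) \<rho>)"
    using assms unfolding bessel_entire_def[of "\<beta> + 2"]
    by (intro sums_diff tail sums_mult summable_sums summable_bessel_coeff) auto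
  then have "bessel_entire (\<beta> + 1) \<rho> - 1 - \<rho> / ?d * bessel_entire (\<beta> + 2) \<rho> = bessel_entire \<beta> \<rho> - 1"
    unfolding summand using tail[OF assms] by (rule sums_unique2)
  then show ?thesis by simp
qed

section \<open>The waves F_n and their derivative along the axis\<close>

definition bessel_wave :: "real \<Rightarrow> nat \<Rightarrow> real \<Rightarrow> real \<Rightarrow> real" where
  "bessel_wave \<alpha> n x \<rho> = bessel_entire (\<alpha> + real n) \<rho> * solid_gegenbauer \<alpha> n x \<rho>"

lemma continuous_on_bessel_wave [continuous_intros]:
  fixes x \<rho> :: "'a :: topological_space \<Rightarrow> real"
  assumes "\<alpha> > - 1 / 2" "continuous_on A x" "continuous_on A \<rho>"
  shows "continuous_on A (\<lambda>t. bessel_wave \<alpha> n (x t) (\<rho> t))"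
  unfolding bessel_wave_def using assms by (auto intro!: continuous_intros)

text \<open>The number b_n. At n = 0 the general formula is 2\<alpha> / (4\<alpha>(\<alpha>+1)),
  which degenerates at \<alpha> = 0, so its cancelled value is given separately.\<close>

definition wave_raising_coeff :: "real \<Rightarrow> nat \<Rightarrow> real" where
  "wave_raising_coeff \<alpha> n =
     (if n = 0 then 1 / (2 * (\<alpha> + 1)) else (real n + 2 * \<alpha>) / (4 * (real n + \<alpha>) * (real n + \<alpha> + 1)))"

lemma wave_raising_coeff_pos: "\<alpha> > - 1 / 2 \<Longrightarrow> wave_raising_coeff \<alpha> n > 0"
  by (cases n) (auto simp: wave_raising_coeff_def)

text \<open>The factor n makes the truncated index n - 1 harmless at n = 0.\<close>

definition bessel_wave_deriv :: "real \<Rightarrow> nat \<Rightarrow> real \<Rightarrow> real \<Rightarrow> real" where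
  "bessel_wave_deriv \<alpha> n x \<rho> =
     real n * bessel_wave \<alpha> (n - 1) x \<rho> - wave_raising_coeff \<alpha> n * bessel_wave \<alpha> (Suc n) x \<rho>"

text \<open>The Bessel factor contributes x H_n G_{n+1}, where H and G are the solid polynomial and
  the Bessel factor. The recurrence splits x H_n into H_{n+1} and \<rho> H_{n-1}; the contiguous
  relation merges the latter with H_{n-1} G_n into H_{n-1} G_{n-1}.\<close>

lemma has_field_derivative_bessel_wave:
  assumes \<alpha>: "\<alpha> > - 1 / 2"
    and x: "(x has_field_derivative 1) (at t)" and \<rho>: "(\<rho> has_field_derivative 2 * x t) (at t)"
  shows "((\<lambda>t. bessel_wave \<alpha> n (x t) (\<rho> t)) has_field_derivative bessel_wave_deriv \<alpha> n (x t) (\<rho> t)) (at t)"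
proof -
  let ?H = "\<lambda>n. solid_gegenbauer \<alpha> n (x t) (\<rho> t)"
  let ?G = "\<lambda>n. bessel_entire (\<alpha> + real n) (\<rho> t)"
  have "((\<lambda>t. bessel_entire (\<alpha> + real n) (\<rho> t)) has_field_derivative
      - ?G (Suc n) / (4 * (\<alpha> + real n + 1)) * (2 * x t)) (at t)"
    using DERIV_chain2[OF has_field_derivative_bessel_entire \<rho>, of "\<alpha> + real n"] \<alpha>
    by (simp add: add_ac)
  from DERIV_mult[OF this has_field_derivative_solid_gegenbauer[OF \<alpha> x \<rho>, of n]]
  have D: "((\<lambda>t. bessel_wave \<alpha> n (x t) (\<rho> t)) has_field_derivative
      - ?G (Suc n) / (4 * (\<alpha> + real n + 1)) * (2 * x t) * ?H n + real n * ?H (n - 1) * ?G n) (at t)"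
    by (simp add: bessel_wave_def[abs_def])
  also have "- ?G (Suc n) / (4 * (\<alpha> + real n + 1)) * (2 * x t) * ?H n + real n * ?H (n - 1) * ?G n =
      bessel_wave_deriv \<alpha> n (x t) (\<rho> t)"
  proof (cases n)
    case 0
    then show ?thesis
      using \<alpha> by (simp add: bessel_wave_deriv_def bessel_wave_def wave_raising_coeff_def field_simps)
  next
    case (Suc m)
    define H0 H1 H2 G0 G1 G2 where "H0 = ?H m" "H1 = ?H (Suc m)" "H2 = ?H (Suc (Suc m))"
      "G0 = ?G m" "G1 = ?G (Suc m)" "G2 = ?G (Suc (Suc m))"
    note defs = this
    define a where "a = real m + 1 + \<alpha>"
    have a: "a > 0" using \<alpha> by (simp add: a_def)
    have H: "2 * a * x t * H1 = (a + \<alpha>) * H2 + (real m + 1) * \<rho> t * H0"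
      using solid_gegenbauer_recurrence[OF \<alpha>, of m "x t" "\<rho> t"] unfolding defs a_def by (simp add: add_ac del: solid_gegenbauer.simps)
    have G: "G1 = G0 + \<rho> t / (4 * a * (a + 1)) * G2"
      using bessel_entire_contiguous[of "\<alpha> + real m" "\<rho> t"] \<alpha> unfolding defs a_def by (simp add: add_ac)
    \<comment> \<open>Common multiple of G2 in both relations: the two terms containing \<rho> q H0
      cancel.\<close>
    define q where "q = G2 / (4 * a * (a + 1))"
    have q: "- G2 / (4 * (a + 1)) * (2 * x t) * H1 = - q * (2 * a * x t * H1)"
      using a by (simp add: q_def divide_simps)
    have G': "G1 = G0 + \<rho> t * q"
      unfolding G q_def by simp
    have "- G2 / (4 * (a + 1)) * (2 * x t) * H1 + (real m + 1) * H0 * G1 =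
        (real m + 1) * (G0 * H0) - (a + \<alpha>) * q * H2"
      unfolding q H G' by (simp add: algebra_simps)
    also have "(a + \<alpha>) * q * H2 = (a + \<alpha>) / (4 * a * (a + 1)) * (G2 * H2)"
      by (simp add: q_def)
    finally show ?thesis
      unfolding defs a_def bessel_wave_deriv_def bessel_wave_def wave_raising_coeff_def Suc
      by (simp add: add_ac del: solid_gegenbauer.simps)
  qed
  finally show ?thesis .
qed

lemma continuous_on_bessel_wave_deriv [continuous_intros]:
  fixes x \<rho> :: "'a :: topological_space \<Rightarrow> real"
  assumes "\<alpha> > - 1 / 2" "continuous_on A x" "continuous_on A \<rho>"
  shows "continuous_on A (\<lambda>t. bessel_wave_deriv \<alpha> n (x t) (\<rho> t))"
  unfolding bessel_wave_deriv_def using assms by (auto intro!: continuous_intros)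

section \<open>Combinatorics of the moment expansion\<close>

text \<open>The Chu-Vandermonde identity for (x+y)_i with x = -j and y = -(a+i-1). Reversing the
  rising factorials of negative arguments turns (x+y)_i into (-1)^i (a+j)_i, and (-j)_m = 0 for m >
  j cuts the sum at min i j.\<close>

lemma sum_pochhammer_Vandermonde:
  fixes a :: real
  assumes "a > 0"
  shows "(\<Sum>m\<le>min i j. 1 / (fact m * pochhammer a m * fact (i - m) * fact (j - m))) =
    pochhammer a (i + j) / (fact i * fact j * pochhammer a i * pochhammer a j)"
proof -
  have pos: "pochhammer a m > 0" for m
    using assms by (rule pochhammer_pos)
  have summand: "real (i choose m) * pochhammer (- real j) m * pochhammer (- (a + real i - 1)) (i - m) =
      (-1) ^ i * (fact i * fact j * pochhammer a i) * (1 / (fact m * pochhammer a m * fact (i - m) * fact (j - m)))"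
    if "m \<le> min i j" for m
  proof -
    have "pochhammer (- real j) m = (-1) ^ m * pochhammer (real (Suc (j - m))) m"
      using that by (simp add: pochhammer_minus of_nat_diff add_ac)
    moreover have "fact j = fact (j - m) * pochhammer (real (Suc (j - m))) m"
      using that pochhammer_product[of "j - m" j "1 :: real"] by (simp add: pochhammer_fact add_ac)
    then have "pochhammer (real (Suc (j - m))) m = fact j / fact (j - m)"
      by (simp add: field_simps)
    ultimately have 1: "pochhammer (- real j) m = (-1) ^ m * (fact j / fact (j - m))" by simp
    have "pochhammer (- (a + real i - 1)) (i - m) = (-1) ^ (i - m) * pochhammer (a + real m) (i - m)"
      using that unfolding pochhammer_minus by (simp add: of_nat_diff)
    also have "pochhammer (a + real m) (i - m) = pochhammer a i / pochhammer a m"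
      using that pochhammer_product[of m i a] pos[of m] by (simp add: field_simps)
    finally have 2: "pochhammer (- (a + real i - 1)) (i - m) = (-1) ^ (i - m) * (pochhammer a i / pochhammer a m)" .
    have 3: "real (i choose m) = fact i / (fact m * fact (i - m))"
      using that by (intro binomial_fact) auto
    have 4: "(-1 :: real) ^ m * (-1) ^ (i - m) = (-1) ^ i"
      using that by (simp flip: power_add)
    show ?thesis unfolding 1 2 3 4[symmetric] by (simp add: mult_ac)
  qed
  have "(-1) ^ i * pochhammer (a + real j) i = pochhammer (- real j + - (a + real i - 1)) i"
    using pochhammer_minus[of "real j + (a + real i - 1)" i] by (simp add: add_ac)
  also have "\<dots> = (\<Sum>m\<le>i. real (i choose m) * pochhammer (- real j) m * pochhammer (- (a + real i - 1)) (i - m))"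
    by (rule pochhammer_binomial_sum)
  also have "\<dots> = (\<Sum>m\<le>min i j. real (i choose m) * pochhammer (- real j) m * pochhammer (- (a + real i - 1)) (i - m))"
    by (rule sum.mono_neutral_right) (auto simp: pochhammer_of_nat_eq_0_iff)
  also have "\<dots> = (-1) ^ i * (fact i * fact j * pochhammer a i) *
      (\<Sum>m\<le>min i j. 1 / (fact m * pochhammer a m * fact (i - m) * fact (j - m)))"
    unfolding sum_distrib_left by (rule sum.cong) (simp_all only: summand atMost_iff)
  finally have "pochhammer (a + real j) i = (fact i * fact j * pochhammer a i) *
      (\<Sum>m\<le>min i j. 1 / (fact m * pochhammer a m * fact (i - m) * fact (j - m)))"
    by simp
  moreover have "pochhammer a (i + j) = pochhammer a j * pochhammer (a + real j) i"
    using pochhammer_product'[of a j i] by (simp add: add.commute)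
  ultimately show ?thesis
    using pos[of i] pos[of j] by (simp add: field_simps)
qed

text \<open>By (2m)! = 4^m (1/2)_m m! the even moments absorb the factorial (2m)!.\<close>

lemma binomial_half_pochhammer:
  assumes "2 * m + l \<le> k"
  shows "real (k choose (2 * m)) * real ((k - 2 * m) choose l) * 4 ^ m * pochhammer (1 / 2) m =
    fact k / (fact m * fact l * fact (k - 2 * m - l))"
proof -
  have "fact (2 * m) = (4 ^ m * pochhammer (1 / 2) m * fact m :: real)"
    using fact_double[of m, where ?'a = real] by (simp add: power_mult)
  moreover have "real (k choose (2 * m)) = fact k / (fact (2 * m) * fact (k - 2 * m))"
    using assms by (intro binomial_fact) auto
  moreover have "real ((k - 2 * m) choose l) = fact (k - 2 * m) / (fact l * fact (k - 2 * m - l))"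
    using assms by (intro binomial_fact) auto
  moreover have "pochhammer (1 / 2 :: real) m > 0" by (intro pochhammer_pos) auto
  ultimately show ?thesis by simp
qed

lemma sum_even_terms:
  fixes f :: "nat \<Rightarrow> 'a :: comm_monoid_add"
  assumes "\<And>p. odd p \<Longrightarrow> f p = 0"
  shows "(\<Sum>p\<le>2 * k. f p) = (\<Sum>m\<le>k. f (2 * m))"
  by (induction k) (simp_all add: assms)

text \<open>The binomial expansion of (b t + X + Y)^k with each t^p replaced by its moment. Only p =
  2m survives; expanding (X+Y)^(k-2m) and collecting the powers of X leaves a Vandermonde sum over m
  as coefficient.\<close>

lemma moment_expansion:
  fixes a :: real and \<mu> :: "nat \<Rightarrow> real"
  assumes a: "a > 0" and b: "b\<^sup>2 = 4 * X * Y"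
    and odd: "\<And>p. odd p \<Longrightarrow> \<mu> p = 0"
    and even: "\<And>m. \<mu> (2 * m) = pochhammer (1 / 2) m / pochhammer a m"
  shows "(\<Sum>p\<le>k. real (k choose p) * b ^ p * (X + Y) ^ (k - p) * \<mu> p) =
    (\<Sum>i\<le>k. fact k * pochhammer a k / (fact i * pochhammer a i * fact (k - i) * pochhammer a (k - i))
       * (X ^ i * Y ^ (k - i)))"
proof -
  let ?c = "\<lambda>m i j. 1 / (fact m * pochhammer a m * fact (i - m) * fact (j - m)) :: real"
  \<comment> \<open>The range is extended to 2k, where the binomial coefficients vanish, so that the
    even indices are 2m with m \<le> k.\<close>
  have "(\<Sum>p\<le>k. real (k choose p) * b ^ p * (X + Y) ^ (k - p) * \<mu> p) =
      (\<Sum>p\<le>2 * k. real (k choose p) * b ^ p * (X + Y) ^ (k - p) * \<mu> p)"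
    by (rule sum.mono_neutral_left) auto
  also have "\<dots> = (\<Sum>m\<le>k. real (k choose (2 * m)) * (4 * X * Y) ^ m * (X + Y) ^ (k - 2 * m)
      * (pochhammer (1 / 2) m / pochhammer a m))"
    by (subst sum_even_terms) (simp_all add: odd even power_mult b)
  also have "\<dots> = (\<Sum>m\<in>{m. 2 * m \<le> k}. real (k choose (2 * m)) * (4 * X * Y) ^ m * (X + Y) ^ (k - 2 * m)
      * (pochhammer (1 / 2) m / pochhammer a m))"
    by (rule sum.mono_neutral_right) auto
  also have "\<dots> = (\<Sum>m\<in>{m. 2 * m \<le> k}. \<Sum>l\<le>k - 2 * m.
      fact k * (?c m (l + m) (k - (l + m)) * (X ^ (l + m) * Y ^ (k - (l + m)))))"
  proof (rule sum.cong)
    fix m assume "m \<in> {m. 2 * m \<le> k}"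
    then have m: "2 * m \<le> k" by simp
    have "real (k choose (2 * m)) * (4 * X * Y) ^ m * (X + Y) ^ (k - 2 * m) * (pochhammer (1 / 2) m / pochhammer a m) =
        (\<Sum>l\<le>k - 2 * m. (real (k choose (2 * m)) * real ((k - 2 * m) choose l) * 4 ^ m * pochhammer (1 / 2) m)
          / pochhammer a m * (X ^ m * X ^ l * (Y ^ m * Y ^ (k - 2 * m - l))))"
      unfolding binomial_ring sum_distrib_left sum_distrib_right
      by (simp add: power_mult_distrib mult_ac)
    also have "\<dots> = (\<Sum>l\<le>k - 2 * m. fact k * (?c m (l + m) (k - (l + m)) * (X ^ (l + m) * Y ^ (k - (l + m)))))"
    proof (rule sum.cong)
      fix l assume "l \<in> {..k - 2 * m}"
      then have l: "2 * m + l \<le> k" using m by simp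
      have e: "k - (l + m) = m + (k - 2 * m - l)" using l by simp
      show "(real (k choose (2 * m)) * real ((k - 2 * m) choose l) * 4 ^ m * pochhammer (1 / 2) m)
          / pochhammer a m * (X ^ m * X ^ l * (Y ^ m * Y ^ (k - 2 * m - l))) =
          fact k * (?c m (l + m) (k - (l + m)) * (X ^ (l + m) * Y ^ (k - (l + m))))"
        unfolding binomial_half_pochhammer[OF l] e power_add by (simp add: mult_ac)
    qed simp
    finally show "real (k choose (2 * m)) * (4 * X * Y) ^ m * (X + Y) ^ (k - 2 * m) * (pochhammer (1 / 2) m / pochhammer a m) =
      (\<Sum>l\<le>k - 2 * m. fact k * (?c m (l + m) (k - (l + m)) * (X ^ (l + m) * Y ^ (k - (l + m)))))" .
  qed simp
  \<comment> \<open>Reindexing by the exponent i = l + m of X: the conditions 2m \<le> k and l \<le>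
    k - 2m become m \<le> i and m \<le> k - i.\<close>
  also have "\<dots> = (\<Sum>i\<le>k. \<Sum>m\<le>min i (k - i). fact k * (?c m i (k - i) * (X ^ i * Y ^ (k - i))))"
  proof -
    have "finite {m. 2 * m \<le> k}" by (rule finite_subset[of _ "{..k}"]) auto
    then show ?thesis
      by (simp add: sum.Sigma)
        (rule sum.reindex_bij_witness[where i = "\<lambda>(i, m). (m, i - m)" and j = "\<lambda>(m, l). (l + m, m)"]; auto)
  qed
  also have "\<dots> = (\<Sum>i\<le>k. fact k * ((\<Sum>m\<le>min i (k - i). ?c m i (k - i)) * (X ^ i * Y ^ (k - i))))"
    by (simp only: sum_distrib_left sum_distrib_right)
  also have "\<dots> = (\<Sum>i\<le>k. fact k * pochhammer a k / (fact i * pochhammer a i * fact (k - i) * pochhammer a (k - i))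
       * (X ^ i * Y ^ (k - i)))"
    unfolding sum_pochhammer_Vandermonde[OF a] by (rule sum.cong) (simp_all add: mult_ac)
  finally show ?thesis .
qed

subsection \<open>Integration against powers of the sine\<close>

lemma absolutely_integrable_continuous_mult:
  fixes g w :: "real \<Rightarrow> real"
  assumes "continuous_on {a..b} g" "w absolutely_integrable_on {a..b}"
  shows "(\<lambda>x. g x * w x) absolutely_integrable_on {a..b}"
proof (rule absolutely_integrable_bounded_measurable_product_real)
  show "g \<in> borel_measurable (lebesgue_on {a..b})"
    using assms(1) by (intro continuous_imp_measurable_on_sets_lebesgue) auto
  show "bounded (g ` {a..b})"
    using assms(1) by (intro compact_imp_bounded compact_continuous_image) auto
qed (use assms in auto)

lemma integrable_continuous_mult:
  fixes g w :: "real \<Rightarrow> real"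
  assumes "continuous_on {a..b} g" "w absolutely_integrable_on {a..b}"
  shows "(\<lambda>x. g x * w x) integrable_on {a..b}"
  using absolutely_integrable_continuous_mult[OF assms] by (rule set_lebesgue_integral_eq_integral(1))

text \<open>Differentiation under the integral against a weight that is only integrable, as
  sin^(2\<alpha>) is unbounded for \<alpha> < 0. By the mean value inequality the difference
  quotients times w are dominated by B |w|, where B bounds f' on a compact set.\<close>

lemma has_field_derivative_integral_mult:
  fixes f f' :: "real \<Rightarrow> real \<Rightarrow> real" and w :: "real \<Rightarrow> real"
  assumes w: "w absolutely_integrable_on {a..b}"
    and f: "\<And>u. continuous_on {a..b} (f u)"
    and D: "\<And>u x. x \<in> {a..b} \<Longrightarrow> ((\<lambda>u. f u x) has_field_derivative f' u x) (at u)"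
    and f': "continuous_on (UNIV \<times> {a..b}) (\<lambda>(u, x). f' u x)"
  shows "((\<lambda>u. integral {a..b} (\<lambda>x. f u x * w x)) has_field_derivative
      integral {a..b} (\<lambda>x. f' u x * w x)) (at u)"
  unfolding has_field_derivative_iff tendsto_at_iff_sequentially
proof (intro allI impI)
  fix X assume X: "\<forall>i. X i \<in> UNIV - {u}" "X \<longlonglongrightarrow> u"
  obtain R where R: "\<And>i. \<bar>X i\<bar> \<le> R"
    using convergent_imp_bounded[OF X(2)] by (auto simp: bounded_iff)
  \<comment> \<open>A compact convex set containing u and the whole sequence, so that one bound on
    f' serves every difference quotient.\<close>
  define S where "S = {- max R \<bar>u\<bar>..max R \<bar>u\<bar>}"
  have S: "X i \<in> S" "u \<in> S" for i
    using R[of i] by (auto simp: S_def)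
  have "compact ((\<lambda>(u, x). f' u x) ` (S \<times> {a..b}))"
    by (intro compact_continuous_image continuous_on_subset[OF f'] compact_Times) (auto simp: S_def)
  then obtain B where B: "\<And>u x. u \<in> S \<Longrightarrow> x \<in> {a..b} \<Longrightarrow> \<bar>f' u x\<bar> \<le> B"
    by (force dest!: compact_imp_bounded simp: bounded_iff)
  define q where "q = (\<lambda>i x. (f (X i) x - f u x) / (X i - u) * w x)"
  have int: "(\<lambda>x. f u x * w x) integrable_on {a..b}" for u
    by (intro integrable_continuous_mult f w)
  have q_eq: "q i = (\<lambda>x. (f (X i) x * w x - f u x * w x) / (X i - u))" for i
    by (simp add: q_def fun_eq_iff left_diff_distrib)
  have "(\<lambda>i. integral {a..b} (q i)) \<longlonglongrightarrow> integral {a..b} (\<lambda>x. f' u x * w x)"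
  proof (rule dominated_convergence(2))
    show "q i integrable_on {a..b}" for i
      unfolding q_eq by (intro integrable_on_divide integrable_diff int)
    show "(\<lambda>x. B * \<bar>w x\<bar>) integrable_on {a..b}"
      using w by (intro integrable_on_mult_right) (auto simp: absolutely_integrable_on_def)
  next
    fix i x assume x: "x \<in> {a..b}"
    have "norm (f (X i) x - f u x) \<le> B * norm (X i - u)"
      using x B S D by (intro field_differentiable_bound[where S = S and f' = "\<lambda>u. f' u x"])
        (auto simp: S_def intro: has_field_derivative_at_within)
    then have "\<bar>(f (X i) x - f u x) / (X i - u)\<bar> \<le> B"
      using X(1) by (simp add: divide_le_eq)
    then show "norm (q i x) \<le> B * \<bar>w x\<bar>"
      unfolding q_def real_norm_def abs_mult by (rule mult_right_mono) simp
  next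
    fix x assume "x \<in> {a..b}"
    then have "(\<lambda>i. (f (X i) x - f u x) / (X i - u)) \<longlonglongrightarrow> f' u x"
      using D[of x u] X unfolding has_field_derivative_iff tendsto_at_iff_sequentially comp_def by blast
    then show "(\<lambda>i. q i x) \<longlonglongrightarrow> f' u x * w x"
      unfolding q_def by (rule tendsto_mult_right)
  qed
  moreover have "integral {a..b} (q i) =
      (integral {a..b} (\<lambda>x. f (X i) x * w x) - integral {a..b} (\<lambda>x. f u x * w x)) / (X i - u)" for i
    unfolding q_eq by (simp add: integral_diff int)
  ultimately show "((\<lambda>y. (integral {a..b} (\<lambda>x. f y x * w x) - integral {a..b} (\<lambda>x. f u x * w x)) / (y - u)) \<circ> X)
      \<longlonglongrightarrow> integral {a..b} (\<lambda>x. f' u x * w x)"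
    by (simp add: comp_def)
qed

section \<open>The weight sin^(2\<alpha>): total mass and integration by parts\<close>

text \<open>Legendre's duplication formula at z = \<alpha> + 1/2. The left side is the total mass of
  the weight in the variable t = (1 - cos \<phi>)/2.\<close>

lemma C_const_Beta:
  assumes "\<alpha> > - 1 / 2"
  shows "2 * 4 powr (\<alpha> - 1 / 2) * Beta (\<alpha> + 1 / 2) (\<alpha> + 1 / 2) = 1 / C_const \<alpha>"
proof -
  define z where "z = \<alpha> + 1 / 2"
  have z: "z > 0" using assms by (simp add: z_def)
  \<comment> \<open>The duplication formula for the complex Gamma function is read at the real point
    z.\<close>
  have "complex_of_real z \<notin> \<int>\<^sub>\<le>\<^sub>0" "complex_of_real z + 1 / 2 \<notin> \<int>\<^sub>\<le>\<^sub>0"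
    using z of_real_in_nonpos_Ints_iff[of z, where ?'a = complex] of_real_in_nonpos_Ints_iff[of "z + 1 / 2", where ?'a = complex]
    by (auto elim!: nonpos_Ints_cases)
  from Gamma_legendre_duplication[OF this]
  have "of_real (Gamma z * Gamma (z + 1 / 2)) = complex_of_real (exp ((1 - 2 * z) * ln 2) * sqrt pi * Gamma (2 * z))"
    by (simp flip: Gamma_complex_of_real exp_of_real)
  then have dup: "Gamma z * Gamma (z + 1 / 2) = exp ((1 - 2 * z) * ln 2) * sqrt pi * Gamma (2 * z)"
    by (simp only: of_real_eq_iff)
  have e: "4 powr (z - 1) * 2 * exp ((1 - 2 * z) * ln 2) = 1"
  proof -
    have "(4 :: real) powr (z - 1) = (2 powr 2) powr (z - 1)" by simp
    also have "\<dots> = 2 powr (2 * z - 2)" by (simp only: powr_powr right_diff_distrib) simp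
    finally have "(4 :: real) powr (z - 1) * 2 * exp ((1 - 2 * z) * ln 2) = 2 powr (2 * z - 2) * 2 powr 1 * 2 powr (1 - 2 * z)"
      by (simp add: powr_def mult_ac)
    also have "\<dots> = 2 powr ((2 * z - 2) + 1 + (1 - 2 * z))" by (simp only: powr_add)
    also have "\<dots> = 1" by simp
    finally show ?thesis .
  qed
  have pos: "Gamma z > 0" "Gamma (z + 1 / 2) > 0" "Gamma (2 * z) > 0"
    using z by (auto intro!: Gamma_real_pos)
  have "2 * 4 powr (z - 1) * (Gamma z * Gamma z / Gamma (2 * z)) * (Gamma (z + 1 / 2)) =
      2 * 4 powr (z - 1) * Gamma z / Gamma (2 * z) * (Gamma z * Gamma (z + 1 / 2))"
    by simp
  also have "\<dots> = (4 powr (z - 1) * 2 * exp ((1 - 2 * z) * ln 2)) * (sqrt pi * Gamma z)"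
    unfolding dup using pos by simp
  finally have "2 * 4 powr (z - 1) * Beta z z * Gamma (z + 1 / 2) = sqrt pi * Gamma z"
    unfolding e by (simp add: Beta_def)
  then have Beta: "2 * 4 powr (z - 1) * Beta z z = sqrt pi * Gamma z / Gamma (z + 1 / 2)"
    using pos by (simp add: eq_divide_eq)
  have C: "C_const \<alpha> = Gamma (z + 1 / 2) / (sqrt pi * Gamma z)"
    by (simp add: C_const_def z_def add_ac)
  have z': "\<alpha> - 1 / 2 = z - 1" "\<alpha> + 1 / 2 = z"
    by (simp_all add: z_def)
  show ?thesis unfolding z' C Beta by simp
qed

lemma C_const_pos: "\<alpha> > - 1 / 2 \<Longrightarrow> C_const \<alpha> > 0"
  unfolding C_const_def by (intro divide_pos_pos mult_pos_pos Gamma_real_pos) auto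

text \<open>The substitution t = (1 - cos \<phi>)/2, with 4t(1-t) = sin^2 \<phi> and dt = (sin
  \<phi> / 2) d\<phi>, leads to a Beta integral. Hence \<open>C_const \<alpha>\<close> normalizes
  the weight to mass 1.\<close>

lemma has_integral_sin_powr:
  assumes \<alpha>: "\<alpha> > - 1 / 2"
  shows "((\<lambda>\<phi>. sin \<phi> powr (2 * \<alpha>)) has_integral 1 / C_const \<alpha>) {0..pi}"
proof -
  define f where "f = (\<lambda>t. 2 * 4 powr (\<alpha> - 1 / 2) * (t powr (\<alpha> - 1 / 2) * (1 - t) powr (\<alpha> - 1 / 2)))"
  define g where "g = (\<lambda>\<phi> :: real. (1 - cos \<phi>) / 2)"
  have "(f has_integral 1 / C_const \<alpha>) {0..1}"
    unfolding f_def C_const_Beta[OF \<alpha>, symmetric]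
    using has_integral_Beta_real[of "\<alpha> + 1 / 2" "\<alpha> + 1 / 2"] \<alpha> by (intro has_integral_mult_right) simp
  then have f: "(f has_integral 1 / C_const \<alpha>) {0<..<1}"
    by (simp only: has_integral_Icc_iff_Ioo)
  have image: "g ` {0<..<pi} = {0<..<1}"
  proof (intro equalityI subsetI)
    fix t assume "t \<in> g ` {0<..<pi}"
    then obtain \<phi> where \<phi>: "0 < \<phi>" "\<phi> < pi" "t = g \<phi>" by auto
    then have "cos \<phi> < 1" "cos \<phi> > -1"
      using cos_monotone_0_pi[of 0 \<phi>] cos_monotone_0_pi[of \<phi> pi] by simp_all
    then show "t \<in> {0<..<1}" using \<phi> by (simp add: g_def)
  next
    fix t :: real assume t: "t \<in> {0<..<1}"
    then have "t = g (arccos (1 - 2 * t))" "arccos (1 - 2 * t) \<in> {0<..<pi}"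
      using arccos_lt_bounded[of "1 - 2 * t"] by (simp_all add: g_def cos_arccos)
    then show "t \<in> g ` {0<..<pi}" by blast
  qed
  have "(\<lambda>\<phi>. \<bar>sin \<phi> / 2\<bar> * f (g \<phi>)) absolutely_integrable_on {0<..<pi} \<and>
      integral {0<..<pi} (\<lambda>\<phi>. \<bar>sin \<phi> / 2\<bar> * f (g \<phi>)) = 1 / C_const \<alpha>"
  proof (rule has_absolute_integral_change_of_variables_1'[where f = f and g = g and g' = "\<lambda>\<phi>. sin \<phi> / 2", THEN iffD2])
    show "inj_on g {0<..<pi}"
      by (rule inj_onI) (auto simp: g_def intro: cos_inj_pi)
    show "f absolutely_integrable_on g ` {0<..<pi} \<and> integral (g ` {0<..<pi}) f = 1 / C_const \<alpha>"
      unfolding image using integral_unique[OF f] has_integral_integrable[OF f]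
      by (auto intro!: nonnegative_absolutely_integrable_1 simp: f_def)
  qed (auto simp: g_def intro!: derivative_eq_intros)
  then have "((\<lambda>\<phi>. \<bar>sin \<phi> / 2\<bar> * f (g \<phi>)) has_integral 1 / C_const \<alpha>) {0<..<pi}"
    by (metis integrable_integral set_lebesgue_integral_eq_integral(1))
  moreover have "\<bar>sin \<phi> / 2\<bar> * f (g \<phi>) = sin \<phi> powr (2 * \<alpha>)" if "\<phi> \<in> {0<..<pi}" for \<phi>
  proof -
    have s: "sin \<phi> > 0" using that by (auto intro: sin_gt_zero)
    have "g \<phi> \<ge> 0" "1 - g \<phi> \<ge> 0"
      using cos_le_one[of \<phi>] cos_ge_minus_one[of \<phi>] unfolding g_def by argo+
    then have "4 powr (\<alpha> - 1 / 2) * (g \<phi> powr (\<alpha> - 1 / 2) * (1 - g \<phi>) powr (\<alpha> - 1 / 2)) =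
        (4 * (g \<phi> * (1 - g \<phi>))) powr (\<alpha> - 1 / 2)"
      by (simp add: powr_mult)
    also have "4 * (g \<phi> * (1 - g \<phi>)) = 1 - (cos \<phi>)\<^sup>2"
      by (simp add: g_def power2_eq_square field_simps)
    also have "\<dots> = sin \<phi> powr 2"
      using s by (simp flip: sin_squared_eq)
    finally have "\<bar>sin \<phi> / 2\<bar> * f (g \<phi>) = sin \<phi> powr 1 * (sin \<phi> powr 2) powr (\<alpha> - 1 / 2)"
      using s by (simp add: f_def)
    also have "\<dots> = sin \<phi> powr (1 + 2 * (\<alpha> - 1 / 2))"
      unfolding powr_powr powr_add ..
    finally show ?thesis by simp
  qed
  ultimately have "((\<lambda>\<phi>. sin \<phi> powr (2 * \<alpha>)) has_integral 1 / C_const \<alpha>) {0<..<pi}"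
    by (rule has_integral_eq[rotated])
  then show ?thesis by (simp only: has_integral_Icc_iff_Ioo)
qed

lemma absolutely_integrable_sin_powr:
  "\<alpha> > - 1 / 2 \<Longrightarrow> (\<lambda>\<phi>. sin \<phi> powr (2 * \<alpha>)) absolutely_integrable_on {0..pi}"
  using has_integral_sin_powr by (intro nonnegative_absolutely_integrable_1) auto

text \<open>Integration by parts, from the derivative of \<open>cos \<phi> ^ p * sin \<phi> powr (2 * \<alpha> + 1)\<close>.\<close>
lemma integral_cos_power_sin_powr_step:
  assumes \<alpha>: "\<alpha> > - 1 / 2"
  shows "(real p + 2 * \<alpha> + 1) * integral {0..pi} (\<lambda>\<phi>. cos \<phi> ^ Suc p * sin \<phi> powr (2 * \<alpha>)) =
    real p * integral {0..pi} (\<lambda>\<phi>. cos \<phi> ^ (p - 1) * sin \<phi> powr (2 * \<alpha>))"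
proof -
  let ?m = "\<lambda>p \<phi>. cos \<phi> ^ p * sin \<phi> powr (2 * \<alpha>)"
  have int: "?m p integrable_on {0..pi}" for p
    by (intro integrable_continuous_mult absolutely_integrable_sin_powr \<alpha> continuous_intros)
  have "((\<lambda>\<phi>. (real p + 2 * \<alpha> + 1) * ?m (Suc p) \<phi> - real p * ?m (p - 1) \<phi>) has_integral
      cos pi ^ p * sin pi powr (2 * \<alpha> + 1) - cos 0 ^ p * sin 0 powr (2 * \<alpha> + 1)) {0..pi}"
  \<comment> \<open>Continuity is enough at the endpoints, where sin^(2\<alpha>+1) vanishes since
    its exponent is positive but need not be differentiable.\<close>
  proof (rule fundamental_theorem_of_calculus_interior)
    show "continuous_on {0..pi} (\<lambda>\<phi>. cos \<phi> ^ p * sin \<phi> powr (2 * \<alpha> + 1))"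
      using \<alpha> by (auto intro!: continuous_intros continuous_on_powr' simp: sin_ge_zero)
    fix \<phi> :: real assume "\<phi> \<in> {0<..<pi}"
    then have s: "sin \<phi> > 0" by (auto intro: sin_gt_zero)
    have "((\<lambda>\<phi>. cos \<phi> ^ p * sin \<phi> powr (2 * \<alpha> + 1)) has_field_derivative
       (real p * cos \<phi> ^ (p - 1) * - sin \<phi>) * sin \<phi> powr (2 * \<alpha> + 1)
        + (2 * \<alpha> + 1) * sin \<phi> powr (2 * \<alpha> + 1 - 1) * cos \<phi> * cos \<phi> ^ p) (at \<phi>)"
      using s by (auto intro!: derivative_eq_intros has_real_derivative_powr simp: powr_diff divide_simps)
    also have "(real p * cos \<phi> ^ (p - 1) * - sin \<phi>) * sin \<phi> powr (2 * \<alpha> + 1)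
        + (2 * \<alpha> + 1) * sin \<phi> powr (2 * \<alpha> + 1 - 1) * cos \<phi> * cos \<phi> ^ p =
        (real p + 2 * \<alpha> + 1) * ?m (Suc p) \<phi> - real p * ?m (p - 1) \<phi>"
    proof -
      have "sin \<phi> * sin \<phi> powr (2 * \<alpha> + 1) = (1 - (cos \<phi>)\<^sup>2) * sin \<phi> powr (2 * \<alpha>)"
        using s by (simp add: powr_add flip: sin_squared_eq) (simp add: power2_eq_square)
      then have "(real p * cos \<phi> ^ (p - 1) * - sin \<phi>) * sin \<phi> powr (2 * \<alpha> + 1) =
          - (real p * cos \<phi> ^ (p - 1) * ((1 - (cos \<phi>)\<^sup>2) * sin \<phi> powr (2 * \<alpha>)))"
        by (metis mult.assoc mult_minus_left mult_minus_right)
      \<comment> \<open>The factor p covers p = 0, where the exponent p - 1 is truncated.\<close>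
      moreover have "real p * (cos \<phi> ^ (p - 1) * (cos \<phi>)\<^sup>2) = real p * cos \<phi> ^ Suc p"
        by (cases p) (simp_all add: power2_eq_square)
      ultimately have "(real p * cos \<phi> ^ (p - 1) * - sin \<phi>) * sin \<phi> powr (2 * \<alpha> + 1) =
          real p * cos \<phi> ^ Suc p * sin \<phi> powr (2 * \<alpha>) - real p * cos \<phi> ^ (p - 1) * sin \<phi> powr (2 * \<alpha>)"
        by (simp only: left_diff_distrib right_diff_distrib mult.assoc[symmetric] mult_1_right minus_diff_eq)
      then show ?thesis by (simp add: ring_distribs mult_ac)
    qed
    finally show "((\<lambda>\<phi>. cos \<phi> ^ p * sin \<phi> powr (2 * \<alpha> + 1)) has_vector_derivative
        (real p + 2 * \<alpha> + 1) * ?m (Suc p) \<phi> - real p * ?m (p - 1) \<phi>) (at \<phi>)"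
      by (simp only: has_real_derivative_iff_has_vector_derivative)
  qed simp
  moreover have "((\<lambda>\<phi>. (real p + 2 * \<alpha> + 1) * ?m (Suc p) \<phi> - real p * ?m (p - 1) \<phi>) has_integral
      (real p + 2 * \<alpha> + 1) * integral {0..pi} (?m (Suc p)) - real p * integral {0..pi} (?m (p - 1))) {0..pi}"
    by (intro has_integral_diff has_integral_mult_right integrable_integral int)
  ultimately show ?thesis
    by (auto dest: has_integral_unique)
qed

section \<open>Spherical means and the moments of the cosine\<close>

text \<open>The mean of a function of the polar angle over the unit sphere in "dimension" 2\<alpha>
  + 2, in which that angle has density C_\<alpha> sin^(2\<alpha>) \<phi>.\<close>

definition sphere_mean :: "real \<Rightarrow> (real \<Rightarrow> real) \<Rightarrow> real" where
  "sphere_mean \<alpha> g = C_const \<alpha> * integral {0..pi} (\<lambda>\<phi>. g \<phi> * sin \<phi> powr (2 * \<alpha>))"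

text \<open>Integration by parts with p = 0 annihilates the first moment, as 2\<alpha> + 1 > 0, and
  in general ties each moment to the one two below.\<close>

lemma sphere_mean_odd:
  assumes "\<alpha> > - 1 / 2" "odd p"
  shows "sphere_mean \<alpha> (\<lambda>\<phi>. cos \<phi> ^ p) = 0"
  using assms(2)
proof (induction p rule: induct_nat_012)
  case 1
  then show ?case using integral_cos_power_sin_powr_step[OF assms(1), of 0] assms(1) by (simp add: sphere_mean_def)
next
  case (ge2 n)
  then show ?case
    using integral_cos_power_sin_powr_step[OF assms(1), of "Suc n"] assms(1) C_const_pos[OF assms(1)]
    by (auto simp: sphere_mean_def)
qed simp

text \<open>The weight has mass 1, and each integration by parts contributes the factor (1/2 + m) /
  (\<alpha> + 1 + m).\<close>

lemma sphere_mean_even: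
  assumes \<alpha>: "\<alpha> > - 1 / 2"
  shows "sphere_mean \<alpha> (\<lambda>\<phi>. cos \<phi> ^ (2 * m)) = pochhammer (1 / 2) m / pochhammer (\<alpha> + 1) m"
proof (induction m)
  case 0
  then show ?case
    using integral_unique[OF has_integral_sin_powr[OF \<alpha>]] C_const_pos[OF \<alpha>] by (simp add: sphere_mean_def)
next
  case (Suc m)
  have "(real (2 * m + 1) + 2 * \<alpha> + 1) * sphere_mean \<alpha> (\<lambda>\<phi>. cos \<phi> ^ (2 * Suc m)) =
      real (2 * m + 1) * sphere_mean \<alpha> (\<lambda>\<phi>. cos \<phi> ^ (2 * m))"
    using integral_cos_power_sin_powr_step[OF \<alpha>, of "2 * m + 1"] by (simp add: sphere_mean_def del: power_Suc)
  moreover have "real (2 * m + 1) + 2 * \<alpha> + 1 = 2 * (\<alpha> + 1 + real m)" "real (2 * m + 1) = 2 * (1 / 2 + real m)"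
    by simp_all
  ultimately have "(\<alpha> + 1 + real m) * sphere_mean \<alpha> (\<lambda>\<phi>. cos \<phi> ^ (2 * Suc m)) =
      (1 / 2 + real m) * (pochhammer (1 / 2) m / pochhammer (\<alpha> + 1) m)"
    unfolding Suc by (simp only: mult.assoc mult_cancel_left) simp
  moreover have "pochhammer (\<alpha> + 1) m > 0" "\<alpha> + 1 + real m > 0"
    using \<alpha> by (auto intro: pochhammer_pos)
  ultimately have "sphere_mean \<alpha> (\<lambda>\<phi>. cos \<phi> ^ (2 * Suc m)) =
      (1 / 2 + real m) * (pochhammer (1 / 2) m / pochhammer (\<alpha> + 1) m) / (\<alpha> + 1 + real m)"
    by (metis less_irrefl mult.commute nonzero_eq_divide_eq)
  then show ?case
    unfolding pochhammer_Suc by (simp add: mult_ac del: power_Suc)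
qed

lemma sphere_mean_sum:
  assumes "\<alpha> > - 1 / 2" "finite A" "\<And>i. i \<in> A \<Longrightarrow> continuous_on {0..pi} (g i)"
  shows "sphere_mean \<alpha> (\<lambda>\<phi>. \<Sum>i\<in>A. c i * g i \<phi>) = (\<Sum>i\<in>A. c i * sphere_mean \<alpha> (g i))"
proof -
  have "integral {0..pi} (\<lambda>\<phi>. (\<Sum>i\<in>A. c i * g i \<phi>) * sin \<phi> powr (2 * \<alpha>)) =
      integral {0..pi} (\<lambda>\<phi>. \<Sum>i\<in>A. c i * (g i \<phi> * sin \<phi> powr (2 * \<alpha>)))"
    by (simp only: sum_distrib_right mult.assoc)
  also have "\<dots> = (\<Sum>i\<in>A. c i * integral {0..pi} (\<lambda>\<phi>. g i \<phi> * sin \<phi> powr (2 * \<alpha>)))"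
    using assms by (subst integral_sum)
      (auto intro!: integrable_on_mult_right integrable_continuous_mult absolutely_integrable_sin_powr)
  finally show ?thesis
    by (simp add: sphere_mean_def sum_distrib_left mult_ac)
qed

text \<open>The moment expansion with X = u^2, Y = v^2, b = -2uv and a = \<alpha> + 1; its factor k!
  (\<alpha>+1)_k cancels against \<open>bessel_coeff \<alpha> k\<close>. The right side is the k-th
  term of the Cauchy product of the series of j_\<alpha>(u) and j_\<alpha>(v).\<close>

lemma sphere_mean_power:
  assumes \<alpha>: "\<alpha> > - 1 / 2"
  shows "bessel_coeff \<alpha> k * sphere_mean \<alpha> (\<lambda>\<phi>. (u\<^sup>2 + v\<^sup>2 - 2 * u * v * cos \<phi>) ^ k) =
    (\<Sum>i\<le>k. (bessel_coeff \<alpha> i * (u\<^sup>2) ^ i) * (bessel_coeff \<alpha> (k - i) * (v\<^sup>2) ^ (k - i)))"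
proof -
  let ?b = "- (2 * u * v)"
  have "sphere_mean \<alpha> (\<lambda>\<phi>. (u\<^sup>2 + v\<^sup>2 - 2 * u * v * cos \<phi>) ^ k) =
      sphere_mean \<alpha> (\<lambda>\<phi>. (?b * cos \<phi> + (u\<^sup>2 + v\<^sup>2)) ^ k)"
    by (simp add: algebra_simps)
  also have "\<dots> = sphere_mean \<alpha> (\<lambda>\<phi>. \<Sum>p\<le>k. real (k choose p) * ?b ^ p * (u\<^sup>2 + v\<^sup>2) ^ (k - p) * cos \<phi> ^ p)"
    unfolding binomial_ring power_mult_distrib by (simp add: mult_ac)
  also have "\<dots> = (\<Sum>p\<le>k. real (k choose p) * ?b ^ p * (u\<^sup>2 + v\<^sup>2) ^ (k - p) * sphere_mean \<alpha> (\<lambda>\<phi>. cos \<phi> ^ p))"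
    by (rule sphere_mean_sum[OF \<alpha>]) (auto intro!: continuous_intros)
  also have "\<dots> = (\<Sum>i\<le>k. fact k * pochhammer (\<alpha> + 1) k /
      (fact i * pochhammer (\<alpha> + 1) i * fact (k - i) * pochhammer (\<alpha> + 1) (k - i)) * ((u\<^sup>2) ^ i * (v\<^sup>2) ^ (k - i)))"
    using \<alpha> by (intro moment_expansion sphere_mean_odd sphere_mean_even)
      (auto simp: power2_eq_square)
  finally have M: "sphere_mean \<alpha> (\<lambda>\<phi>. (u\<^sup>2 + v\<^sup>2 - 2 * u * v * cos \<phi>) ^ k) = \<dots>" .
  have pos: "pochhammer (\<alpha> + 1) k > 0"
    using \<alpha> by (intro pochhammer_pos) auto
  show ?thesis
    unfolding M sum_distrib_left
  proof (rule sum.cong)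
    fix i assume "i \<in> {..k}"
    then have "(- 1 / 4 :: real) ^ k = (- 1 / 4) ^ i * (- 1 / 4) ^ (k - i)"
      by (simp flip: power_add)
    then have "bessel_coeff \<alpha> k * (fact k * pochhammer (\<alpha> + 1) k) = (- 1 / 4) ^ i * (- 1 / 4) ^ (k - i)"
      using pos by (simp add: bessel_coeff_def)
    then show "bessel_coeff \<alpha> k * (fact k * pochhammer (\<alpha> + 1) k /
        (fact i * pochhammer (\<alpha> + 1) i * fact (k - i) * pochhammer (\<alpha> + 1) (k - i)) * ((u\<^sup>2) ^ i * (v\<^sup>2) ^ (k - i))) =
        (bessel_coeff \<alpha> i * (u\<^sup>2) ^ i) * (bessel_coeff \<alpha> (k - i) * (v\<^sup>2) ^ (k - i))"
      unfolding times_divide_eq_right times_divide_eq_left mult.assoc[symmetric]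
      by (simp add: bessel_coeff_def mult_ac)
  qed simp
qed

subsection \<open>The mean value property\<close>

text \<open>Gegenbauer's product formula, the case n = 0. The squared distance is at most R = (|u| +
  |v|)^2, so the absolute series at R dominates all partial sums and the mean may be taken term by
  term; the result is a Cauchy product.\<close>

lemma bessel_product_formula:
  assumes \<alpha>: "\<alpha> > - 1 / 2"
  shows "sphere_mean \<alpha> (\<lambda>\<phi>. bessel_entire \<alpha> (u\<^sup>2 + v\<^sup>2 - 2 * u * v * cos \<phi>)) =
    bessel_entire \<alpha> (u\<^sup>2) * bessel_entire \<alpha> (v\<^sup>2)"
proof -
  define \<rho> where "\<rho> = (\<lambda>\<phi>. u\<^sup>2 + v\<^sup>2 - 2 * u * v * cos \<phi>)"
  define R where "R = u\<^sup>2 + v\<^sup>2 + 2 * \<bar>u\<bar> * \<bar>v\<bar>"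
  have \<rho>: "\<bar>\<rho> \<phi>\<bar> \<le> R" for \<phi>
  proof -
    have "\<bar>2 * u * v * cos \<phi>\<bar> \<le> 2 * \<bar>u\<bar> * \<bar>v\<bar>"
      by (simp add: abs_mult mult_left_le)
    moreover have "\<bar>u\<^sup>2 + v\<^sup>2\<bar> = u\<^sup>2 + v\<^sup>2" by simp
    ultimately show ?thesis unfolding \<rho>_def R_def by linarith
  qed
  let ?w = "\<lambda>\<phi>. sin \<phi> powr (2 * \<alpha>)"
  let ?c = "bessel_coeff \<alpha>"
  define f where "f = (\<lambda>K \<phi>. (\<Sum>k<K. ?c k * \<rho> \<phi> ^ k) * ?w \<phi>)"
  define B where "B = (\<Sum>k. norm (?c k * R ^ k))"
  have "(\<lambda>K. integral {0..pi} (f K)) \<longlonglongrightarrow> integral {0..pi} (\<lambda>\<phi>. bessel_entire \<alpha> (\<rho> \<phi>) * ?w \<phi>)"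
  proof (rule dominated_convergence(2))
    show "f K integrable_on {0..pi}" for K
      unfolding f_def \<rho>_def
      by (intro integrable_continuous_mult absolutely_integrable_sin_powr \<alpha> continuous_intros)
    show "(\<lambda>\<phi>. B * ?w \<phi>) integrable_on {0..pi}"
      using has_integral_sin_powr[OF \<alpha>] by (intro integrable_on_mult_right has_integral_integrable)
  next
    fix K \<phi> assume "\<phi> \<in> {0..pi}"
    have "norm (\<Sum>k<K. ?c k * \<rho> \<phi> ^ k) \<le> (\<Sum>k<K. norm (?c k * R ^ k))"
      using \<rho>[of \<phi>] by (intro sum_norm_le) (auto simp: abs_mult power_abs intro!: mult_left_mono power_mono)
    also have "\<dots> \<le> B"
      unfolding B_def using summable_norm_bessel_coeff[OF \<alpha>] by (intro sum_le_suminf) auto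
    finally show "norm (f K \<phi>) \<le> B * ?w \<phi>"
      unfolding f_def norm_mult by (intro mult_mono) auto
  next
    fix \<phi> assume "\<phi> \<in> {0..pi}"
    show "(\<lambda>K. f K \<phi>) \<longlonglongrightarrow> bessel_entire \<alpha> (\<rho> \<phi>) * ?w \<phi>"
      unfolding f_def bessel_entire_def
      using summable_LIMSEQ[OF summable_bessel_coeff[OF \<alpha>]] by (rule tendsto_mult_right)
  qed
  then have "(\<lambda>K. C_const \<alpha> * integral {0..pi} (f K)) \<longlonglongrightarrow> sphere_mean \<alpha> (\<lambda>\<phi>. bessel_entire \<alpha> (\<rho> \<phi>))"
    unfolding sphere_mean_def by (rule tendsto_mult_left)
  moreover have "C_const \<alpha> * integral {0..pi} (f K) =
      (\<Sum>k<K. \<Sum>i\<le>k. (?c i * (u\<^sup>2) ^ i) * (?c (k - i) * (v\<^sup>2) ^ (k - i)))" for K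
  proof -
    have "C_const \<alpha> * integral {0..pi} (f K) = sphere_mean \<alpha> (\<lambda>\<phi>. \<Sum>k<K. ?c k * \<rho> \<phi> ^ k)"
      by (simp add: sphere_mean_def f_def)
    also have "\<dots> = (\<Sum>k<K. ?c k * sphere_mean \<alpha> (\<lambda>\<phi>. \<rho> \<phi> ^ k))"
      unfolding \<rho>_def by (intro sphere_mean_sum \<alpha> continuous_intros) auto
    finally show ?thesis
      unfolding \<rho>_def sphere_mean_power[OF \<alpha>] .
  qed
  ultimately have "(\<lambda>k. \<Sum>i\<le>k. (?c i * (u\<^sup>2) ^ i) * (?c (k - i) * (v\<^sup>2) ^ (k - i))) sums
      sphere_mean \<alpha> (\<lambda>\<phi>. bessel_entire \<alpha> (\<rho> \<phi>))"
    by (simp add: sums_def)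
  moreover have "(\<lambda>k. \<Sum>i\<le>k. (?c i * (u\<^sup>2) ^ i) * (?c (k - i) * (v\<^sup>2) ^ (k - i))) sums
      (bessel_entire \<alpha> (u\<^sup>2) * bessel_entire \<alpha> (v\<^sup>2))"
    unfolding bessel_entire_def by (intro Cauchy_product_sums summable_norm_bessel_coeff \<alpha>)
  ultimately show ?thesis
    unfolding \<rho>_def by (rule sums_unique2)
qed

text \<open>For fixed \<phi>, moving the centre carries the point of the sphere along the axis: x =
  u - v cos \<phi> has derivative 1 in u and the squared distance has derivative 2x.\<close>

lemma has_field_derivative_sphere_mean_wave:
  assumes \<alpha>: "\<alpha> > - 1 / 2"
  shows "((\<lambda>u. sphere_mean \<alpha> (\<lambda>\<phi>. bessel_wave \<alpha> n (u - v * cos \<phi>) (u\<^sup>2 + v\<^sup>2 - 2 * u * v * cos \<phi>)))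
    has_field_derivative
      sphere_mean \<alpha> (\<lambda>\<phi>. bessel_wave_deriv \<alpha> n (u - v * cos \<phi>) (u\<^sup>2 + v\<^sup>2 - 2 * u * v * cos \<phi>))) (at u)"
  unfolding sphere_mean_def
proof (intro DERIV_cmult has_field_derivative_integral_mult absolutely_integrable_sin_powr \<alpha>)
  show "((\<lambda>u. bessel_wave \<alpha> n (u - v * cos \<phi>) (u\<^sup>2 + v\<^sup>2 - 2 * u * v * cos \<phi>)) has_field_derivative
      bessel_wave_deriv \<alpha> n (u - v * cos \<phi>) (u\<^sup>2 + v\<^sup>2 - 2 * u * v * cos \<phi>)) (at u)" for u \<phi>
    by (rule has_field_derivative_bessel_wave[OF \<alpha>]) (auto intro!: derivative_eq_intros simp: algebra_simps)
qed (auto intro!: continuous_intros \<alpha> simp: case_prod_unfold)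

lemma sphere_mean_bessel_wave_deriv:
  assumes \<alpha>: "\<alpha> > - 1 / 2" and x: "continuous_on {0..pi} x" and \<rho>: "continuous_on {0..pi} \<rho>"
  shows "sphere_mean \<alpha> (\<lambda>\<phi>. bessel_wave_deriv \<alpha> n (x \<phi>) (\<rho> \<phi>)) =
     real n * sphere_mean \<alpha> (\<lambda>\<phi>. bessel_wave \<alpha> (n - 1) (x \<phi>) (\<rho> \<phi>))
       - wave_raising_coeff \<alpha> n * sphere_mean \<alpha> (\<lambda>\<phi>. bessel_wave \<alpha> (Suc n) (x \<phi>) (\<rho> \<phi>))"
proof -
  define c where "c = (\<lambda>i. if i = Suc n then - wave_raising_coeff \<alpha> n else real n)"
  \<comment> \<open>Even with truncation at n = 0 the two indices are distinct, so the sum over the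
    set has two terms.\<close>
  have [simp]: "n - Suc 0 \<noteq> Suc n" by simp
  have "bessel_wave_deriv \<alpha> n y \<sigma> = (\<Sum>i\<in>{n - 1, Suc n}. c i * bessel_wave \<alpha> i y \<sigma>)" for y \<sigma>
    by (simp add: bessel_wave_deriv_def c_def)
  moreover have "sphere_mean \<alpha> (\<lambda>\<phi>. \<Sum>i\<in>{n - 1, Suc n}. c i * bessel_wave \<alpha> i (x \<phi>) (\<rho> \<phi>)) =
      (\<Sum>i\<in>{n - 1, Suc n}. c i * sphere_mean \<alpha> (\<lambda>\<phi>. bessel_wave \<alpha> i (x \<phi>) (\<rho> \<phi>)))"
    by (intro sphere_mean_sum continuous_intros \<alpha> x \<rho>) auto
  ultimately show ?thesis
    by (simp add: c_def)
qed

text \<open>Stated for every real u, so that the identity for n can be differentiated in u.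
  Comparing derivatives relates the identities for n - 1 and n + 1, and b_n > 0 isolates the
  latter.\<close>

lemma sphere_mean_bessel_wave:
  assumes \<alpha>: "\<alpha> > - 1 / 2"
  shows "sphere_mean \<alpha> (\<lambda>\<phi>. bessel_wave \<alpha> n (u - v * cos \<phi>) (u\<^sup>2 + v\<^sup>2 - 2 * u * v * cos \<phi>)) =
    bessel_wave \<alpha> n u (u\<^sup>2) * bessel_entire \<alpha> (v\<^sup>2)"
proof -
  define M where "M = (\<lambda>n u. sphere_mean \<alpha> (\<lambda>\<phi>. bessel_wave \<alpha> n (u - v * cos \<phi>) (u\<^sup>2 + v\<^sup>2 - 2 * u * v * cos \<phi>)))"
  define J where "J = bessel_entire \<alpha> (v\<^sup>2)"
  have deriv: "real n * M (n - 1) u - wave_raising_coeff \<alpha> n * M (Suc n) u =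
      bessel_wave_deriv \<alpha> n u (u\<^sup>2) * J"
    if IH: "\<And>u. M n u = bessel_wave \<alpha> n u (u\<^sup>2) * J" for n u
  proof -
    have "(M n has_field_derivative
        sphere_mean \<alpha> (\<lambda>\<phi>. bessel_wave_deriv \<alpha> n (u - v * cos \<phi>) (u\<^sup>2 + v\<^sup>2 - 2 * u * v * cos \<phi>))) (at u)"
      unfolding M_def by (rule has_field_derivative_sphere_mean_wave[OF \<alpha>])
    \<comment> \<open>The path x = u, \<rho> = u^2 also runs along the axis, so the right side obeys
      the same derivative formula.\<close>
    moreover have "((\<lambda>u. bessel_wave \<alpha> n u (u\<^sup>2) * J) has_field_derivative bessel_wave_deriv \<alpha> n u (u\<^sup>2) * J) (at u)"
      by (intro DERIV_cmult_right has_field_derivative_bessel_wave[OF \<alpha>]) (auto intro!: derivative_eq_intros)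
    moreover have "M n = (\<lambda>u. bessel_wave \<alpha> n u (u\<^sup>2) * J)" using IH by blast
    ultimately have "sphere_mean \<alpha> (\<lambda>\<phi>. bessel_wave_deriv \<alpha> n (u - v * cos \<phi>) (u\<^sup>2 + v\<^sup>2 - 2 * u * v * cos \<phi>)) =
        bessel_wave_deriv \<alpha> n u (u\<^sup>2) * J"
      by (metis DERIV_unique)
    then show ?thesis
      unfolding M_def by (subst (asm) sphere_mean_bessel_wave_deriv[OF \<alpha>]) (auto intro!: continuous_intros)
  qed
  \<comment> \<open>The assumption \<open>low\<close> carries the factor n, so it is trivial at n =
    0 and the step also starts the induction.\<close>
  have step: "M (Suc n) u = bessel_wave \<alpha> (Suc n) u (u\<^sup>2) * J"
    if "\<And>u. M n u = bessel_wave \<alpha> n u (u\<^sup>2) * J"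
      and low: "real n * M (n - 1) u = real n * (bessel_wave \<alpha> (n - 1) u (u\<^sup>2) * J)" for n u
  proof -
    have "wave_raising_coeff \<alpha> n * M (Suc n) u = wave_raising_coeff \<alpha> n * (bessel_wave \<alpha> (Suc n) u (u\<^sup>2) * J)"
      using deriv[OF that(1), of u] unfolding low bessel_wave_deriv_def by (simp add: left_diff_distrib mult.assoc)
    then show ?thesis
      using wave_raising_coeff_pos[OF \<alpha>, of n] by simp
  qed
  have M_0: "M 0 u = bessel_wave \<alpha> 0 u (u\<^sup>2) * J" for u
    using bessel_product_formula[OF \<alpha>] by (simp add: M_def J_def bessel_wave_def)
  have "\<forall>u. M n u = bessel_wave \<alpha> n u (u\<^sup>2) * J"
  proof (induction n rule: induct_nat_012)
    case 0
    show ?case using M_0 by blast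
  next
    case 1
    show ?case using step[OF M_0] by simp
  next
    case (ge2 n)
    then show ?case using step[of "Suc n"] by simp
  qed
  then show ?thesis by (simp add: M_def J_def)
qed

subsection \<open>Passage to the distance variable\<close>

text \<open>As a sum of squares the radicand is nonnegative, and its vanishing forces u - v cos
  \<phi> = 0.\<close>

lemma sq_dist_eq: "u\<^sup>2 + v\<^sup>2 - 2 * u * v * cos \<phi> = (u - v * cos \<phi>)\<^sup>2 + (v * sin \<phi>)\<^sup>2"
  for u v \<phi> :: real
  by (simp add: power_mult_distrib sin_squared_eq power2_diff algebra_simps)

lemma delta_squared: "(delta u v \<phi>)\<^sup>2 = u\<^sup>2 + v\<^sup>2 - 2 * u * v * cos \<phi>"
  unfolding delta_def by (rule real_sqrt_pow2) (simp add: sq_dist_eq)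

text \<open>The value chosen for \<open>delta_gegen\<close> at distance 0 is that of the solid
  polynomial at the origin, so the identity needs no exception there.\<close>

lemma bessel_j_mult_delta_gegen:
  assumes \<alpha>: "\<alpha> > - 1 / 2"
  shows "bessel_j (\<alpha> + real n) (delta u v \<phi>) * delta_gegen n \<alpha> u v \<phi> =
    bessel_wave \<alpha> n (u - v * cos \<phi>) (u\<^sup>2 + v\<^sup>2 - 2 * u * v * cos \<phi>)"
proof -
  have "delta_gegen n \<alpha> u v \<phi> = solid_gegenbauer \<alpha> n (u - v * cos \<phi>) ((delta u v \<phi>)\<^sup>2)"
  proof (cases "delta u v \<phi> = 0")
    case True
    then have "(u - v * cos \<phi>)\<^sup>2 + (v * sin \<phi>)\<^sup>2 = 0"
      using delta_squared[of u v \<phi>] by (simp add: sq_dist_eq)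
    then have "u - v * cos \<phi> = 0" by (simp only: sum_power2_eq_zero_iff)
    then show ?thesis using True by (simp add: delta_gegen_def solid_gegenbauer_origin)
  next
    case False
    then show ?thesis by (simp add: delta_gegen_def solid_gegenbauer_eq_norm_gegenbauer[OF \<alpha>])
  qed
  then show ?thesis
    using \<alpha> by (simp add: bessel_wave_def bessel_j_eq_bessel_entire delta_squared)
qed

text \<open>The mean value property in the original notation. Absolute integrability is recorded
  with the value because the change of variables relies on it.\<close>

lemma bessel_addition_integral:
  fixes \<alpha> u v :: real and n :: nat
  assumes \<alpha>: "\<alpha> > - 1 / 2"
  defines "F \<equiv> \<lambda>\<phi>. C_const \<alpha> * bessel_j (\<alpha> + real n) (delta u v \<phi>) * delta_gegen n \<alpha> u v \<phi> * sin \<phi> powr (2 * \<alpha>)"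
  shows "F absolutely_integrable_on {0..pi}"
    and "(F has_integral (u ^ n * bessel_j (\<alpha> + real n) u * bessel_j \<alpha> v)) {0..pi}"
proof -
  let ?W = "\<lambda>\<phi>. bessel_wave \<alpha> n (u - v * cos \<phi>) (u\<^sup>2 + v\<^sup>2 - 2 * u * v * cos \<phi>)"
  have F: "F = (\<lambda>\<phi>. C_const \<alpha> * ?W \<phi> * sin \<phi> powr (2 * \<alpha>))"
    unfolding F_def bessel_j_mult_delta_gegen[OF \<alpha>, symmetric] by (simp add: mult.assoc)
  show abs: "F absolutely_integrable_on {0..pi}"
    unfolding F by (intro absolutely_integrable_continuous_mult absolutely_integrable_sin_powr continuous_intros \<alpha>)
  have "integral {0..pi} F = sphere_mean \<alpha> ?W"
    by (simp add: F sphere_mean_def mult.assoc)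
  also have "\<dots> = u ^ n * bessel_j (\<alpha> + real n) u * bessel_j \<alpha> v"
    unfolding sphere_mean_bessel_wave[OF \<alpha>]
    using \<alpha> by (simp add: bessel_wave_def solid_gegenbauer_axis bessel_j_eq_bessel_entire)
  finally show "(F has_integral (u ^ n * bessel_j (\<alpha> + real n) u * bessel_j \<alpha> v)) {0..pi}"
    using set_lebesgue_integral_eq_integral(1)[OF abs] by (simp add: has_integral_integrable_integral)
qed

lemma delta_pos:
  assumes "u > 0" "v > 0" "\<phi> \<in> {0<..<pi}"
  shows "delta u v \<phi> > 0"
proof -
  have "sin \<phi> > 0" using assms by (auto intro: sin_gt_zero)
  then have "(u - v * cos \<phi>)\<^sup>2 + (v * sin \<phi>)\<^sup>2 > 0"
    using assms by (intro add_nonneg_pos) auto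
  then show ?thesis unfolding delta_def sq_dist_eq by simp
qed

lemma has_field_derivative_delta:
  assumes "delta u v \<phi> > 0"
  shows "(delta u v has_field_derivative u * v * sin \<phi> / delta u v \<phi>) (at \<phi>)"
proof -
  have "u\<^sup>2 + v\<^sup>2 - 2 * u * v * cos \<phi> > 0"
    using assms by (simp add: delta_def)
  then show ?thesis
    unfolding delta_def[abs_def] by (auto intro!: derivative_eq_intros simp: field_simps)
qed

text \<open>By the law of cosines the distance determines cos \<phi>, and every w strictly between
  |u - v| and u + v is the third side of a nondegenerate triangle.\<close>

lemma bij_betw_delta:
  assumes "u > 0" "v > 0"
  shows "bij_betw (delta u v) {0<..<pi} {\<bar>u - v\<bar><..<u + v}"
proof (rule bij_betw_imageI)
  show "inj_on (delta u v) {0<..<pi}"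
  proof (rule inj_onI)
    fix x y assume "x \<in> {0<..<pi}" "y \<in> {0<..<pi}" "delta u v x = delta u v y"
    moreover from this have "cos x = cos y"
      using assms delta_squared[of u v x] delta_squared[of u v y] by simp
    ultimately show "x = y" by (auto intro: cos_inj_pi)
  qed
  show "delta u v ` {0<..<pi} = {\<bar>u - v\<bar><..<u + v}"
  proof (intro equalityI subsetI)
    fix w assume "w \<in> delta u v ` {0<..<pi}"
    then obtain \<phi> where \<phi>: "0 < \<phi>" "\<phi> < pi" "w = delta u v \<phi>" by auto
    then have c: "cos \<phi> < 1" "cos \<phi> > -1"
      using cos_monotone_0_pi[of 0 \<phi>] cos_monotone_0_pi[of \<phi> pi] by simp_all
    have w: "w > 0" using \<phi> delta_pos[OF assms] by simp
    have w2: "w\<^sup>2 = u\<^sup>2 + v\<^sup>2 - 2 * u * v * cos \<phi>" using \<phi> delta_squared by simp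
    have "u * v * cos \<phi> < u * v * 1" "u * v * (-1) < u * v * cos \<phi>"
      using c assms by (intro mult_strict_left_mono; simp)+
    then have "\<bar>u - v\<bar>\<^sup>2 < w\<^sup>2" "w\<^sup>2 < (u + v)\<^sup>2"
      unfolding w2 by (simp_all add: power2_eq_square algebra_simps)
    then have "\<bar>u - v\<bar> < w" "w < u + v"
      using power_less_imp_less_base[of "\<bar>u - v\<bar>" 2 w] power_less_imp_less_base[of w 2 "u + v"] w assms by linarith+
    then show "w \<in> {\<bar>u - v\<bar><..<u + v}" by simp
  next
    fix w assume w: "w \<in> {\<bar>u - v\<bar><..<u + v}"
    \<comment> \<open>The cosine of the angle between sides u and v that faces w.\<close>
    define c where "c = (u\<^sup>2 + v\<^sup>2 - w\<^sup>2) / (2 * u * v)"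
    have "\<bar>u - v\<bar>\<^sup>2 < w\<^sup>2" "w\<^sup>2 < (u + v)\<^sup>2"
      using w power_strict_mono[of "\<bar>u - v\<bar>" w 2] power_strict_mono[of w "u + v" 2] by auto
    then have "u\<^sup>2 + v\<^sup>2 - w\<^sup>2 < 2 * u * v" "- (2 * u * v) < u\<^sup>2 + v\<^sup>2 - w\<^sup>2"
      by (simp_all add: power2_sum power2_diff)
    moreover have uv: "2 * u * v > 0" using assms by simp
    ultimately have c: "-1 < c" "c < 1"
      unfolding c_def less_divide_eq divide_less_eq by simp_all
    have "2 * u * v * c = u\<^sup>2 + v\<^sup>2 - w\<^sup>2"
      using uv assms by (simp add: c_def)
    then have "u\<^sup>2 + v\<^sup>2 - 2 * u * v * cos (arccos c) = w\<^sup>2"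
      using c by (simp add: cos_arccos)
    moreover have "w > 0"
      using w by (auto intro: le_less_trans[OF abs_ge_zero])
    ultimately have "w = delta u v (arccos c)"
      by (simp add: delta_def)
    then show "w \<in> delta u v ` {0<..<pi}"
      using arccos_lt_bounded[OF c] by auto
  qed
qed

text \<open>By Heron's formula the product inside the kernel is (2uv sin \<phi>)^2, sixteen times
  the squared area of the triangle. With the Jacobian uv sin \<phi> / w, the measure K_B
  w^(2\<alpha>+1) dw pulls back to the angular weight.\<close>

lemma bessel_kernel_delta:
  assumes "u > 0" "v > 0" "\<phi> \<in> {0<..<pi}"
  defines "d \<equiv> delta u v \<phi>"
  shows "u * v * sin \<phi> / d * (bessel_kernel \<alpha> u v d * d powr (2 * \<alpha> + 1)) = C_const \<alpha> * sin \<phi> powr (2 * \<alpha>)"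
proof -
  define p s where "p = u * v" "s = sin \<phi>"
  have pos: "d > 0" "p > 0" "s > 0"
    using assms delta_pos by (auto simp: p_s_def intro: sin_gt_zero)
  have range: "\<bar>u - v\<bar> < d" "d < u + v"
    using bij_betw_imp_surj_on[OF bij_betw_delta[OF assms(1,2)]] assms(3) unfolding d_def by auto
  have d2: "d\<^sup>2 = u\<^sup>2 + v\<^sup>2 - 2 * p * cos \<phi>"
    unfolding d_def p_s_def delta_squared by simp
  have "((u + v)\<^sup>2 - d\<^sup>2) * (d\<^sup>2 - (u - v)\<^sup>2) = (2 * p)\<^sup>2 * ((1 + cos \<phi>) * (1 - cos \<phi>))"
    unfolding d2 by (simp add: p_s_def power2_eq_square algebra_simps)
  also have "\<dots> = (2 * p * s)\<^sup>2"
    by (simp add: p_s_def power_mult_distrib sin_squared_eq) (simp add: power2_eq_square algebra_simps)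
  also have "\<dots> = (2 * p * s) powr 2"
    using pos by simp
  finally have X: "((u + v)\<^sup>2 - d\<^sup>2) * (d\<^sup>2 - (u - v)\<^sup>2) = (2 * p * s) powr 2" .
  have "2 * (\<alpha> - 1 / 2) = 2 * \<alpha> - 1" by simp
  then have P: "((2 * p * s) powr 2) powr (\<alpha> - 1 / 2) =
      2 powr (2 * \<alpha> - 1) * (p powr (2 * \<alpha>) / p) * (s powr (2 * \<alpha>) / s)"
    unfolding powr_powr using pos by (simp add: powr_mult powr_diff)
  have two: "2 powr (- 2 * \<alpha> + 1) * 2 powr (2 * \<alpha> - 1) = (1 :: real)"
    unfolding powr_add[symmetric] by simp
  have "bessel_kernel \<alpha> u v d = 2 powr (- 2 * \<alpha> + 1) * C_const \<alpha> *
      ((2 * p * s) powr 2) powr (\<alpha> - 1 / 2) / (p * d) powr (2 * \<alpha>)"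
    unfolding X[symmetric] unfolding p_s_def(1) bessel_kernel_def using range by simp
  also have "\<dots> = (2 powr (- 2 * \<alpha> + 1) * 2 powr (2 * \<alpha> - 1)) * C_const \<alpha> *
      (p powr (2 * \<alpha>) / p) * (s powr (2 * \<alpha>) / s) / (p powr (2 * \<alpha>) * d powr (2 * \<alpha>))"
    unfolding P powr_mult[of p d] by (simp add: mult_ac)
  finally have K: "bessel_kernel \<alpha> u v d =
      C_const \<alpha> * (p powr (2 * \<alpha>) / p) * (s powr (2 * \<alpha>) / s) / (p powr (2 * \<alpha>) * d powr (2 * \<alpha>))"
    unfolding two by simp
  have cancel: "p * s / d * (c * (A / p) * (E / s) / (A * B) * (B * d)) = c * E"
    if "A > 0" "B > 0" for A B c E :: real
    using pos that by (simp add: field_simps)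
  have "d powr (2 * \<alpha> + 1) = d powr (2 * \<alpha>) * d"
    using pos by (simp add: powr_add)
  then show ?thesis
    using cancel[of "p powr (2 * \<alpha>)" "d powr (2 * \<alpha>)" "C_const \<alpha>" "s powr (2 * \<alpha>)"] pos
    unfolding K by (simp only: p_s_def powr_gt_zero)
qed

theorem theorem3p1:
  fixes \<alpha> :: real and n :: nat
  assumes "\<alpha> > - 1 / 2"
  shows "(\<forall>u v. u \<ge> 0 \<longrightarrow> v \<ge> 0 \<longrightarrow>
           ((\<lambda>\<phi>. C_const \<alpha> * bessel_j (\<alpha> + real n) (delta u v \<phi>) * delta_gegen n \<alpha> u v \<phi>
                    * sin \<phi> powr (2 * \<alpha>))
             has_integral (u ^ n * bessel_j (\<alpha> + real n) u * bessel_j \<alpha> v)) {0..pi})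
       \<and> (\<forall>u v. u > 0 \<longrightarrow> v > 0 \<longrightarrow>
           ((\<lambda>w. w ^ n * bessel_j (\<alpha> + real n) w * bessel_kernel \<alpha> u v w
                  * norm_gegenbauer n \<alpha> ((u^2 + w^2 - v^2) / (2 * u * w)) * w powr (2 * \<alpha> + 1))
             has_integral (u ^ n * bessel_j (\<alpha> + real n) u * bessel_j \<alpha> v)) {0<..})"
proof (intro conjI allI impI)
  fix u v :: real
  assume uv: "u > 0" "v > 0"
  define F where "F = (\<lambda>\<phi>. C_const \<alpha> * bessel_j (\<alpha> + real n) (delta u v \<phi>) * delta_gegen n \<alpha> u v \<phi>
      * sin \<phi> powr (2 * \<alpha>))"
  define f where "f = (\<lambda>w. w ^ n * bessel_j (\<alpha> + real n) w * bessel_kernel \<alpha> u v w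
      * norm_gegenbauer n \<alpha> ((u^2 + w^2 - v^2) / (2 * u * w)) * w powr (2 * \<alpha> + 1))"
  define I where "I = u ^ n * bessel_j (\<alpha> + real n) u * bessel_j \<alpha> v"
  define g' where "g' = (\<lambda>\<phi>. u * v * sin \<phi> / delta u v \<phi>)"
  \<comment> \<open>The endpoints are dropped: for u = v the distance vanishes at \<phi> = 0 and is
    not differentiable there.\<close>
  have F: "F absolutely_integrable_on {0<..<pi}" "integral {0<..<pi} F = I"
    using bessel_addition_integral[OF assms, of n u v]
    unfolding F_def I_def absolutely_integrable_on_Icc_iff_Ioo has_integral_Icc_iff_Ioo
    by (auto intro: integral_unique)
  have eq: "\<bar>g' \<phi>\<bar> * f (delta u v \<phi>) = F \<phi>" if \<phi>: "\<phi> \<in> {0<..<pi}" for \<phi>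
  proof -
    define d where "d = delta u v \<phi>"
    have d: "d > 0" using delta_pos[OF uv \<phi>] by (simp add: d_def)
    have "sin \<phi> > 0" using \<phi> by (auto intro: sin_gt_zero)
    then have g': "\<bar>g' \<phi>\<bar> = u * v * sin \<phi> / d" using uv d by (simp add: g'_def d_def)
    \<comment> \<open>The law of cosines identifies the two arguments of the Gegenbauer
      polynomial.\<close>
    have "u\<^sup>2 + d\<^sup>2 - v\<^sup>2 = 2 * u * (u - v * cos \<phi>)"
      unfolding d_def delta_squared by (simp add: power2_eq_square algebra_simps)
    then have arg: "(u\<^sup>2 + d\<^sup>2 - v\<^sup>2) / (2 * u * d) = (u - v * cos \<phi>) / d"
      using uv by simp
    have "delta_gegen n \<alpha> u v \<phi> = d ^ n * norm_gegenbauer n \<alpha> ((u\<^sup>2 + d\<^sup>2 - v\<^sup>2) / (2 * u * d))"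
      unfolding arg using d by (simp add: delta_gegen_def flip: d_def)
    then have "\<bar>g' \<phi>\<bar> * f d = bessel_j (\<alpha> + real n) d * delta_gegen n \<alpha> u v \<phi> *
        (u * v * sin \<phi> / d * (bessel_kernel \<alpha> u v d * d powr (2 * \<alpha> + 1)))"
      unfolding g' f_def by (simp add: mult_ac)
    also have "\<dots> = F \<phi>"
      unfolding d_def bessel_kernel_delta[OF uv \<phi>] F_def by (simp add: mult_ac)
    finally show ?thesis by (simp add: d_def)
  qed
  have "(\<lambda>\<phi>. \<bar>g' \<phi>\<bar> * f (delta u v \<phi>)) absolutely_integrable_on {0<..<pi} \<and>
      integral {0<..<pi} (\<lambda>\<phi>. \<bar>g' \<phi>\<bar> * f (delta u v \<phi>)) = I"
  proof
    show "(\<lambda>\<phi>. \<bar>g' \<phi>\<bar> * f (delta u v \<phi>)) absolutely_integrable_on {0<..<pi}"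
      using F(1) by (rule absolutely_integrable_spike[OF _ negligible_empty]) (simp only: eq Diff_empty)
    show "integral {0<..<pi} (\<lambda>\<phi>. \<bar>g' \<phi>\<bar> * f (delta u v \<phi>)) = I"
      unfolding F(2)[symmetric] using eq by (rule integral_cong)
  qed
  moreover have "(\<lambda>\<phi>. \<bar>g' \<phi>\<bar> * f (delta u v \<phi>)) absolutely_integrable_on {0<..<pi} \<and>
      integral {0<..<pi} (\<lambda>\<phi>. \<bar>g' \<phi>\<bar> * f (delta u v \<phi>)) = I \<longleftrightarrow>
      f absolutely_integrable_on delta u v ` {0<..<pi} \<and> integral (delta u v ` {0<..<pi}) f = I"
  proof (rule has_absolute_integral_change_of_variables_1')
    show "(delta u v has_field_derivative g' \<phi>) (at \<phi> within {0<..<pi})" if "\<phi> \<in> {0<..<pi}" for \<phi>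
      unfolding g'_def
      by (rule has_field_derivative_at_within[OF has_field_derivative_delta[OF delta_pos[OF uv that]]])
    show "inj_on (delta u v) {0<..<pi}"
      using bij_betw_delta[OF uv] by (rule bij_betw_imp_inj_on)
  qed simp
  ultimately have "f absolutely_integrable_on {\<bar>u - v\<bar><..<u + v}" "integral {\<bar>u - v\<bar><..<u + v} f = I"
    unfolding bij_betw_imp_surj_on[OF bij_betw_delta[OF uv]] by blast+
  then have "(f has_integral I) {\<bar>u - v\<bar><..<u + v}"
    using set_lebesgue_integral_eq_integral(1) by (simp add: has_integral_iff)
  \<comment> \<open>The kernel is zero outside the triangle range, so extending the domain adds
    nothing.\<close>
  then show "(f has_integral I) {0<..}"
    by (rule has_integral_on_superset) (auto simp: f_def bessel_kernel_def)
qed (rule bessel_addition_integral(2)[OF assms])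

end
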